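(* Let $d\geq 3$ and $n\geq 2$, and let $K_n$ be the complete graph on vertex set $[n]=\{1,\dots,n\}$. Then the irreducible components of the picture space $\mathcal{X}^d(K_n)$ are exactly the cellule closures $\overline{\mathcal{X}^d_\sigma(K_n)}$, where $\sigma$ ranges over all set partitions of $[n]$ with no blocks of size two.
   Context: Let $\mathbb{F}$ be an algebraically closed field and $\mathbb{P}^d$ the projective $d$-space over $\mathbb{F}$. Let $G$ be a finite simple graph with vertex set $V$ and edge set $E$. A picture $P$ of $G$ in $\mathbb{P}^d$ consists of a point $P(v)\in\mathbb{P}^d$ for each vertex $v$ and a line $P(e)\subseteq\mathbb{P}^d$ for each edge $e$, such that $P(v)\in P(e)$ whenever $v$ is an endpoint of $e$. The picture space $\mathcal{X}^d(G)$ is the set of all pictures of $G$, regarded as a Zariski-closed (reduced) algebraic subset of the product of $|V|$ copies of $\mathbb{P}^d$ and $|E|$ copies of the Grassmannian of lines in $\mathbb{P}^d$. For a set partition $\pi$ of $V$, write $v\sim_\pi w$ if $v,w$ lie in the same block of $\pi$. The cellule of $\pi$ is $\mathcal{X}^d_\pi(G)=\{P\in\mathcal{X}^d(G) : P(v)=P(w)\iff v\sim_\pi w\}$. The bar denotes Zariski closure in $\mathcal{X}^d(G)$. *)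

theory Defs
  imports "HOL-Analysis.Analysis" "HOL-Computational_Algebra.Polynomial"
begin

definition irreducible_space :: "'a topology \<Rightarrow> bool" where
  "irreducible_space X \<longleftrightarrow> topspace X \<noteq> {} \<and>
     (\<forall>A B. closedin X A \<and> closedin X B \<and> A \<union> B = topspace X
        \<longrightarrow> A = topspace X \<or> B = topspace X)"

definition irreducible_in :: "'a topology \<Rightarrow> 'a set \<Rightarrow> bool" where
  "irreducible_in X S \<longleftrightarrow> S \<subseteq> topspace X \<and> irreducible_space (subtopology X S)"

definition irreducible_components :: "'a topology \<Rightarrow> 'a set set" where
  "irreducible_components X =
     {S. irreducible_in X S \<and> (\<forall>T. irreducible_in X T \<and> S \<subseteq> T \<longrightarrow> T = S)}"

text \<open>
  Projective \<open>d\<close>-space over \<open>'a\<close> is the set of one-dimensional subspaces of \<open>'a ^ 'd\<close>, where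
  \<open>CARD('d) = d + 1\<close>. A line in it is given by a two-dimensional subspace, so that incidence of a
  point and a line is inclusion of subspaces, and \<open>proj_lines\<close> is the Grassmannian of lines.
\<close>

definition proj_points :: "('a::field ^ 'd) set set" where
  "proj_points = {p. vec.subspace p \<and> vec.dim p = 1}"

definition proj_lines :: "('a::field ^ 'd) set set" where
  "proj_lines = {l. vec.subspace l \<and> vec.dim l = 2}"

text \<open>The Pluecker coordinates of the line spanned by \<open>a\<close> and \<open>b\<close>: the \<open>2 \<times> 2\<close> minors
  of the matrix with columns \<open>a\<close> and \<open>b\<close>.\<close>

definition pluecker :: "'a::field ^ 'd \<Rightarrow> 'a ^ 'd \<Rightarrow> 'a ^ 'd ^ 'd" where
  "pluecker a b = (\<chi> i j. a $ i * b $ j - a $ j * b $ i)"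

type_synonym ('a, 'd, 'v) picture = "('v \<Rightarrow> ('a ^ 'd) set) \<times> ('v set \<Rightarrow> ('a ^ 'd) set)"

definition ambient :: "'v set \<Rightarrow> 'v set set \<Rightarrow> ('a::field, 'd::finite, 'v) picture set" where
  "ambient V E = (V \<rightarrow>\<^sub>E proj_points) \<times> (E \<rightarrow>\<^sub>E proj_lines)"

text \<open>
  \<open>x\<close> and \<open>p\<close> are homogeneous coordinates of \<open>P\<close>: \<open>x v\<close> is a coordinate vector of the point
  at \<open>v\<close>, and \<open>p e\<close> is a Pluecker vector of the line at \<open>e\<close>.
\<close>

definition hom_coords :: "'v set \<Rightarrow> 'v set set \<Rightarrow> ('a::field, 'd::finite, 'v) picture
    \<Rightarrow> ('v \<Rightarrow> 'a ^ 'd) \<Rightarrow> ('v set \<Rightarrow> 'a ^ 'd ^ 'd) \<Rightarrow> bool" where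
  "hom_coords V E P x p \<longleftrightarrow>
     (\<forall>v\<in>V. vec.span {x v} = fst P v) \<and>
     (\<forall>e\<in>E. \<exists>a b. vec.span {a, b} = snd P e \<and> p e = pluecker a b)"

text \<open>
  \<open>multihom V E m f\<close>: \<open>f\<close> is a multihomogeneous polynomial in the point coordinates
  \<open>x v $ i\<close> (\<open>v \<in> V\<close>) and the Pluecker coordinates \<open>p e $ i $ j\<close> (\<open>e \<in> E\<close>). The multiset \<open>m\<close>
  is its multidegree: the degree of \<open>f\<close> in the coordinates of the factor \<open>k\<close> is \<open>count m k\<close>,
  with \<open>k = Inl v\<close> for the projective space at \<open>v\<close> and \<open>k = Inr e\<close> for the Grassmannian at \<open>e\<close>.
  Polynomials are identified with polynomial functions, as one may over an infinite field.
\<close>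

inductive multihom :: "'v set \<Rightarrow> 'v set set \<Rightarrow> ('v + 'v set) multiset
    \<Rightarrow> (('v \<Rightarrow> 'a::field ^ 'd) \<Rightarrow> ('v set \<Rightarrow> 'a ^ 'd ^ 'd) \<Rightarrow> 'a) \<Rightarrow> bool"
  for V E where
  const: "multihom V E {#} (\<lambda>x p. c)"
| point_coord: "v \<in> V \<Longrightarrow> multihom V E {#Inl v#} (\<lambda>x p. x v $ i)"
| line_coord: "e \<in> E \<Longrightarrow> multihom V E {#Inr e#} (\<lambda>x p. p e $ i $ j)"
| add: "multihom V E m f \<Longrightarrow> multihom V E m g \<Longrightarrow> multihom V E m (\<lambda>x p. f x p + g x p)"
| mult: "multihom V E m f \<Longrightarrow> multihom V E m' g \<Longrightarrow> multihom V E (m + m') (\<lambda>x p. f x p * g x p)"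

definition zero_locus :: "'v set \<Rightarrow> 'v set set
    \<Rightarrow> (('v \<Rightarrow> 'a::field ^ 'd::finite) \<Rightarrow> ('v set \<Rightarrow> 'a ^ 'd ^ 'd) \<Rightarrow> 'a) set
    \<Rightarrow> ('a, 'd, 'v) picture set" where
  "zero_locus V E F =
     {P \<in> ambient V E. \<forall>f\<in>F. \<forall>x p. hom_coords V E P x p \<longrightarrow> f x p = 0}"

definition zariski_closed :: "'v set \<Rightarrow> 'v set set
    \<Rightarrow> ('a::field, 'd::finite, 'v) picture set \<Rightarrow> bool" where
  "zariski_closed V E Z \<longleftrightarrow>
     (\<exists>F. (\<forall>f\<in>F. \<exists>m. multihom V E m f) \<and> Z = zero_locus V E F)"

definition zariski :: "'v set \<Rightarrow> 'v set set \<Rightarrow> ('a::field, 'd::finite, 'v) picture topology" where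
  "zariski V E = topology (\<lambda>U. U \<subseteq> ambient V E \<and> zariski_closed V E (ambient V E - U))"

lemma multihom_scale:
  assumes "multihom V E m f"
    and "\<And>v. v \<in> V \<Longrightarrow> x' v = l (Inl v) *s x v"
    and "\<And>e. e \<in> E \<Longrightarrow> p' e = (\<chi> i j. l (Inr e) * p e $ i $ j)"
  shows "f x' p' = (\<Prod>k\<in>#m. l k) * f x p"
  using assms(1)
  by induction (simp_all add: assms(2,3) algebra_simps)

lemma pluecker_scale:
  assumes "vec.span {a', b'} = vec.span {a, b}"
  shows "\<exists>c. pluecker a' b' = (\<chi> i j. c * pluecker a b $ i $ j)"
proof -
  have *: "\<exists>s t. y = s *s a + t *s b" if "y \<in> {a', b'}" for y
  proof -
    have "y \<in> vec.span {a, b}"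
      using that assms vec.span_base by metis
    then obtain s where "y - s *s a \<in> vec.span {b}"
      by (auto simp: vec.span_insert)
    then obtain t where "y - s *s a = t *s b"
      by (auto simp: vec.span_singleton)
    then show ?thesis
      by (metis add.commute diff_add_cancel)
  qed
  obtain s t where a': "a' = s *s a + t *s b" using * by blast
  obtain u w where b': "b' = u *s a + w *s b" using * by blast
  show ?thesis
    by (rule exI[of _ "s * w - t * u"])
       (simp add: a' b' pluecker_def vec_eq_iff algebra_simps)
qed

text \<open>Vanishing does not depend on the choice of homogeneous coordinates.\<close>

lemma multihom_zero_indep:
  assumes f: "multihom V E m f" and xp: "hom_coords V E P x p" and xp': "hom_coords V E P x' p'"
    and 0: "f x p = 0"
  shows "f x' p' = 0"
proof -
  have "\<exists>c. x' v = c *s x v" if "v \<in> V" for v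
  proof -
    have "x' v \<in> vec.span {x v}"
      using that xp xp' vec.span_base[of "x' v" "{x' v}"] by (auto simp: hom_coords_def)
    then show ?thesis by (auto simp: vec.span_singleton)
  qed
  then obtain cx where cx: "\<And>v. v \<in> V \<Longrightarrow> x' v = cx v *s x v" by metis
  have "\<exists>c. p' e = (\<chi> i j. c * p e $ i $ j)" if "e \<in> E" for e
    using that xp xp' pluecker_scale unfolding hom_coords_def by metis
  then obtain cp where cp: "\<And>e. e \<in> E \<Longrightarrow> p' e = (\<chi> i j. cp e * p e $ i $ j)" by metis
  have "f x' p' = (\<Prod>k\<in>#m. case_sum cx cp k) * f x p"
    by (rule multihom_scale[OF f]) (simp_all add: cx cp)
  then show ?thesis using 0 by simp
qed

lemma hom_coords_exist:
  assumes "P \<in> ambient V E"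
  shows "\<exists>x p. hom_coords V E P x p"
proof -
  have "\<exists>y. vec.span {y} = fst P v" if "v \<in> V" for v
  proof -
    have s: "vec.subspace (fst P v)" "vec.dim (fst P v) = 1"
      using assms that by (auto simp: ambient_def proj_points_def PiE_iff)
    obtain B where B: "B \<subseteq> fst P v" "vec.independent B" "fst P v \<subseteq> vec.span B"
        "card B = vec.dim (fst P v)"
      using vec.basis_exists by metis
    obtain y where "B = {y}" using B(4) s(2) by (auto simp: card_1_singleton_iff)
    then show ?thesis using B s(1) vec.span_minimal by blast
  qed
  then obtain x where x: "\<And>v. v \<in> V \<Longrightarrow> vec.span {x v} = fst P v" by metis
  have "\<exists>q a b. vec.span {a, b} = snd P e \<and> q = pluecker a b" if "e \<in> E" for e
  proof -
    have s: "vec.subspace (snd P e)" "vec.dim (snd P e) = 2"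
      using assms that by (auto simp: ambient_def proj_lines_def PiE_iff)
    obtain B where B: "B \<subseteq> snd P e" "vec.independent B" "snd P e \<subseteq> vec.span B"
        "card B = vec.dim (snd P e)"
      using vec.basis_exists by metis
    obtain a b where "B = {a, b}" using B(4) s(2) by (auto simp: card_2_iff)
    then show ?thesis using B s(1) vec.span_minimal by blast
  qed
  then have "\<forall>e\<in>E. \<exists>q. \<exists>a b. vec.span {a, b} = snd P e \<and> q = pluecker a b" by blast
  from bchoice[OF this] obtain p where
    p: "\<forall>e\<in>E. \<exists>a b. vec.span {a, b} = snd P e \<and> p e = pluecker a b" ..
  show ?thesis using x p unfolding hom_coords_def by blast
qed

lemma zariski_closed_Un:
  assumes "zariski_closed V E Y" "zariski_closed V E Z"
  shows "zariski_closed V E (Y \<union> Z)"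
proof -
  obtain F where F: "\<And>f. f \<in> F \<Longrightarrow> \<exists>m. multihom V E m f" and Y: "Y = zero_locus V E F"
    using assms(1) by (auto simp: zariski_closed_def)
  obtain G where G: "\<And>g. g \<in> G \<Longrightarrow> \<exists>m. multihom V E m g" and Z: "Z = zero_locus V E G"
    using assms(2) by (auto simp: zariski_closed_def)
  define H where "H = {(\<lambda>x p. f x p * g x p) |f g. f \<in> F \<and> g \<in> G}"
  have H: "\<exists>m. multihom V E m h" if "h \<in> H" for h
    using that F G multihom.mult unfolding H_def by blast
  have "P \<in> Y \<union> Z" if P: "P \<in> zero_locus V E H" for P
  proof (rule ccontr)
    assume "P \<notin> Y \<union> Z"
    then obtain f x p g x' p' where f: "f \<in> F" "hom_coords V E P x p" "f x p \<noteq> 0"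
      and g: "g \<in> G" "hom_coords V E P x' p'" "g x' p' \<noteq> 0"
      using P unfolding Y Z zero_locus_def by blast
    have "g x p \<noteq> 0" using multihom_zero_indep f(2) g G by metis
    moreover have "f x p * g x p = 0"
    proof -
      have fg: "(\<lambda>x p. f x p * g x p) \<in> H" using f(1) g(1) unfolding H_def by blast
      have "\<forall>h\<in>H. \<forall>x p. hom_coords V E P x p \<longrightarrow> h x p = 0"
        using P by (simp add: zero_locus_def)
      from this fg have "\<forall>x p. hom_coords V E P x p \<longrightarrow> f x p * g x p = 0"
        by (rule bspec)
      then show ?thesis using f(2) by blast
    qed
    ultimately show False using f(3) by simp
  qed
  moreover have "P \<in> zero_locus V E H" if "P \<in> Y \<union> Z" for P
  proof -
    have "P \<in> ambient V E" using that by (auto simp: Y Z zero_locus_def)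
    moreover have "h x p = 0" if h: "h \<in> H" and xp: "hom_coords V E P x p" for h x p
    proof -
      obtain f g where fg: "f \<in> F" "g \<in> G" "h = (\<lambda>x p. f x p * g x p)"
        using h unfolding H_def by blast
      have "f x p = 0 \<or> g x p = 0"
        using \<open>P \<in> Y \<union> Z\<close> fg(1,2) xp by (auto simp: Y Z zero_locus_def)
      then show ?thesis by (auto simp: fg(3))
    qed
    ultimately show ?thesis unfolding zero_locus_def by blast
  qed
  ultimately have "Y \<union> Z = zero_locus V E H" by blast
  with H show ?thesis unfolding zariski_closed_def by blast
qed

lemma zariski_closed_Inter:
  assumes "\<And>Z. Z \<in> \<Z> \<Longrightarrow> zariski_closed V E Z"
  shows "zariski_closed V E (ambient V E \<inter> \<Inter>\<Z>)"
proof -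
  obtain F where F: "\<And>Z. Z \<in> \<Z> \<Longrightarrow> (\<forall>f\<in>F Z. \<exists>m. multihom V E m f) \<and> Z = zero_locus V E (F Z)"
    using assms unfolding zariski_closed_def by metis
  have "P \<in> ambient V E \<inter> \<Inter>\<Z> \<longleftrightarrow> P \<in> zero_locus V E (\<Union>(F ` \<Z>))" for P
  proof -
    have "P \<in> ambient V E \<inter> \<Inter>\<Z> \<longleftrightarrow> P \<in> ambient V E \<and> (\<forall>Z\<in>\<Z>. P \<in> zero_locus V E (F Z))"
      using F by blast
    then show ?thesis by (auto simp: zero_locus_def)
  qed
  then have "ambient V E \<inter> \<Inter>\<Z> = zero_locus V E (\<Union>(F ` \<Z>))" by blast
  moreover have "\<forall>f\<in>\<Union>(F ` \<Z>). \<exists>m. multihom V E m f"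
    using F by (metis (no_types, lifting) UN_E)
  ultimately show ?thesis unfolding zariski_closed_def by metis
qed

lemma openin_zariski:
  fixes U :: "('a::field, 'd::finite, 'v) picture set"
  shows "openin (zariski V E) U \<longleftrightarrow> U \<subseteq> ambient V E \<and> zariski_closed V E (ambient V E - U)"
proof -
  have "istopology (\<lambda>U :: ('a, 'd, 'v) picture set. U \<subseteq> ambient V E \<and> zariski_closed V E (ambient V E - U))"
    unfolding istopology_def
  proof (intro conjI allI impI)
    fix S T :: "('a, 'd, 'v) picture set"
    assume "S \<subseteq> ambient V E \<and> zariski_closed V E (ambient V E - S)"
      and "T \<subseteq> ambient V E \<and> zariski_closed V E (ambient V E - T)"
    then show "S \<inter> T \<subseteq> ambient V E" "zariski_closed V E (ambient V E - S \<inter> T)"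
      using zariski_closed_Un by (auto simp: Diff_Int)
  next
    fix K :: "('a, 'd, 'v) picture set set"
    assume K: "\<forall>U\<in>K. U \<subseteq> ambient V E \<and> zariski_closed V E (ambient V E - U)"
    then show "\<Union>K \<subseteq> ambient V E" by blast
    have eq: "ambient V E - \<Union>K = ambient V E \<inter> \<Inter>((\<lambda>U. ambient V E - U) ` K)" by blast
    show "zariski_closed V E (ambient V E - \<Union>K)"
      unfolding eq by (rule zariski_closed_Inter) (use K in blast)
  qed
  then show ?thesis by (simp add: zariski_def topology_inverse')
qed

lemma topspace_zariski: "topspace (zariski V E) = ambient V E"
proof
  show "topspace (zariski V E) \<subseteq> ambient V E"
    using openin_zariski openin_topspace by metis
  have "zero_locus V E {\<lambda>x p. 1} = {}"
    using hom_coords_exist by (fastforce simp: zero_locus_def)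
  then have "zariski_closed V E {}"
    unfolding zariski_closed_def using multihom.const by (metis singletonD)
  then have "openin (zariski V E) (ambient V E)"
    by (simp add: openin_zariski)
  then show "ambient V E \<subseteq> topspace (zariski V E)"
    by (rule openin_subset)
qed

lemma closedin_zariski: "closedin (zariski V E) Z \<longleftrightarrow> zariski_closed V E Z"
proof -
  have "Z \<subseteq> ambient V E" if "zariski_closed V E Z"
    using that by (auto simp: zariski_closed_def zero_locus_def)
  then show ?thesis
    by (auto simp: closedin_def topspace_zariski openin_zariski double_diff)
qed

text \<open>A simple graph is given by its vertex set \<open>V\<close> and a set \<open>E\<close> of two-element subsets of \<open>V\<close>.\<close>

definition picture_space :: "'v set \<Rightarrow> 'v set set \<Rightarrow> ('a::field, 'd::finite, 'v) picture set" where
  "picture_space V E = {P \<in> ambient V E. \<forall>e\<in>E. \<forall>v\<in>e. fst P v \<subseteq> snd P e}"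

definition picture_topology ::
    "'v set \<Rightarrow> 'v set set \<Rightarrow> ('a::field, 'd::finite, 'v) picture topology" where
  "picture_topology V E = subtopology (zariski V E) (picture_space V E)"

definition cellule ::
    "'v set \<Rightarrow> 'v set set \<Rightarrow> 'v set set \<Rightarrow> ('a::field, 'd::finite, 'v) picture set" where
  "cellule V E \<pi> = {P \<in> picture_space V E.
     \<forall>v\<in>V. \<forall>w\<in>V. fst P v = fst P w \<longleftrightarrow> (\<exists>B\<in>\<pi>. v \<in> B \<and> w \<in> B)}"

definition complete_edges :: "'v set \<Rightarrow> 'v set set" where
  "complete_edges V = {e. e \<subseteq> V \<and> card e = 2}"

end

theory Submission
  imports Defs
begin

text \<open>
  A picture in a cellule is given by coordinate vectors satisfying linear equations and finitely
  many open conditions, so any two such pictures are joined by a line in coordinate space on which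
  multihomogeneous functions become univariate polynomials; hence cellules are irreducible.
  Where a block \<open>{v, w}\<close> has size two, the point of \<open>w\<close> can be moved away from that of \<open>v\<close> along the
  line of the edge \<open>{v, w}\<close>, so the closures of the cellules without such blocks cover the space.
  Conversely, if the cellule of \<open>\<sigma>\<close> lies in the closure of that of \<open>\<tau>\<close>, then \<open>\<tau>\<close> refines \<open>\<sigma>\<close>
  because coincidence of points is a closed condition. If the refinement is strict, some block of
  \<open>\<sigma>\<close> contains \<open>u, v, w\<close> not all equivalent under \<open>\<tau>\<close>; then the lines of \<open>uv\<close>, \<open>uw\<close>, \<open>vw\<close> are
  coplanar on the closure for \<open>\<tau>\<close>, but as \<open>d \<ge> 3\<close> they need not be so on the cellule of \<open>\<sigma>\<close>.
\<close>

section \<open>Polynomial curves\<close>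

text \<open>Over a finite field, the product of all factors \<open>X - a\<close>, increased by one,
  has positive degree but takes the value one everywhere, so it has no root.\<close>

lemma infinite_UNIV_alg_closed: "infinite (UNIV :: 'a::alg_closed_field set)"
proof
  assume fin: "finite (UNIV :: 'a set)"
  define q :: "'a poly" where "q = (\<Prod>a\<in>UNIV. [:- a, 1:])"
  have "degree q = card (UNIV :: 'a set)"
    unfolding q_def by (subst degree_prod_sum_eq) auto
  then have "degree (q + 1) > 0"
    using fin by (subst degree_add_eq_left) (auto simp: finite_UNIV_card_ge_0)
  then obtain z where "poly (q + 1) z = 0"
    using alg_closed_imp_poly_has_root by blast
  moreover have "poly q z = 0"
    using fin by (auto simp: q_def poly_prod)
  ultimately show False by simp
qed

text \<open>A predicate on functions, to match \<open>multihom\<close>, which also speaks of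
  polynomial functions.\<close>

definition polyfun :: "('a::field \<Rightarrow> 'a) \<Rightarrow> bool" where
  "polyfun h \<longleftrightarrow> (\<exists>q. \<forall>t. h t = poly q t)"

lemma polyfun_const [simp, intro]: "polyfun (\<lambda>t. c)"
  unfolding polyfun_def by (rule exI[of _ "[:c:]"]) simp

lemma polyfun_id [simp, intro]: "polyfun (\<lambda>t. t)"
  unfolding polyfun_def by (rule exI[of _ "[:0, 1:]"]) simp

lemma polyfun_add [intro]: "polyfun f \<Longrightarrow> polyfun g \<Longrightarrow> polyfun (\<lambda>t. f t + g t)"
  unfolding polyfun_def by (metis poly_add)

lemma polyfun_diff [intro]: "polyfun f \<Longrightarrow> polyfun g \<Longrightarrow> polyfun (\<lambda>t. f t - g t)"
  unfolding polyfun_def by (metis poly_diff)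

lemma polyfun_mult [intro]: "polyfun f \<Longrightarrow> polyfun g \<Longrightarrow> polyfun (\<lambda>t. f t * g t)"
  unfolding polyfun_def by (metis poly_mult)

lemma polyfun_finite_zeros:
  assumes "polyfun h" "h t0 \<noteq> 0"
  shows "finite {t. h t = 0}"
proof -
  obtain q where q: "\<And>t. h t = poly q t" using assms(1) by (auto simp: polyfun_def)
  then have "q \<noteq> 0" using assms(2) by auto
  then show ?thesis by (simp add: q poly_roots_finite)
qed

lemma polyfun_finite_zeros_vec:
  fixes h :: "'a::field \<Rightarrow> 'a ^ 'd::finite"
  assumes "\<And>i. polyfun (\<lambda>t. h t $ i)" "h t0 \<noteq> 0"
  shows "finite {t. h t = 0}"
proof -
  obtain i where "h t0 $ i \<noteq> 0" using assms(2) by (auto simp: vec_eq_iff)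
  then have "finite {t. h t $ i = 0}"
    using polyfun_finite_zeros assms(1) by blast
  then show ?thesis by (rule rev_finite_subset) auto
qed

text \<open>Along a coordinatewise polynomial curve, each constructor of \<open>multihom\<close>
  yields a univariate polynomial function. Vanishing along the curve thus becomes a question about
  finitely many roots.\<close>

lemma polyfun_multihom:
  assumes "multihom V E m f"
    and "\<And>v i. v \<in> V \<Longrightarrow> polyfun (\<lambda>t. x t v $ i)"
    and "\<And>e i j. e \<in> E \<Longrightarrow> polyfun (\<lambda>t. p t e $ i $ j)"
  shows "polyfun (\<lambda>t. f (x t) (p t))"
  using assms(1) by induction (auto simp: assms(2,3))

lemma multihom_cmult: "multihom V E m f \<Longrightarrow> multihom V E m (\<lambda>x p. c * f x p)"
  using multihom.mult[OF multihom.const, of V E m f c] by simp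

lemma multihom_diff:
  assumes "multihom V E m f" "multihom V E m g"
  shows "multihom V E m (\<lambda>x p. f x p - g x p)"
  using multihom.add[OF assms(1) multihom_cmult[OF assms(2), of "- 1"]] by simp

lemma polyfun_pluecker:
  assumes "\<And>i. polyfun (\<lambda>t. a t $ i)" "\<And>i. polyfun (\<lambda>t. b t $ i)"
  shows "polyfun (\<lambda>t. pluecker (a t) (b t) $ i $ j)"
  by (simp add: pluecker_def) (intro polyfun_diff polyfun_mult assms)

lemma finite_pluecker_zeros:
  fixes a b :: "'a::field \<Rightarrow> 'a ^ 'd::finite"
  assumes "\<And>i. polyfun (\<lambda>t. a t $ i)" "\<And>i. polyfun (\<lambda>t. b t $ i)"
    and "pluecker (a t0) (b t0) \<noteq> 0"
  shows "finite {t. pluecker (a t) (b t) = 0}"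
proof -
  obtain i where "pluecker (a t0) (b t0) $ i \<noteq> 0" using assms(3) by (auto simp: vec_eq_iff)
  then have "finite {t. pluecker (a t) (b t) $ i = 0}"
    by (rule polyfun_finite_zeros_vec[rotated]) (intro polyfun_pluecker assms)
  then show ?thesis by (rule rev_finite_subset) auto
qed

section \<open>Points and lines\<close>

text \<open>At an index \<open>i\<close> with \<open>a $ i \<noteq> 0\<close>, the vanishing minors
  determine every \<open>b $ j\<close> from \<open>b $ i\<close>. Linear dependence thereby becomes
  a polynomial condition.\<close>

lemma pluecker_eq_0_iff:
  fixes a b :: "'a::field ^ 'd::finite"
  assumes "a \<noteq> 0"
  shows "pluecker a b = 0 \<longleftrightarrow> b \<in> vec.span {a}"
proof
  assume 0: "pluecker a b = 0"
  obtain i where i: "a $ i \<noteq> 0" using assms by (auto simp: vec_eq_iff)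
  have "b = (b $ i / a $ i) *s a"
  proof (subst vec_eq_iff, intro allI)
    fix j
    have "pluecker a b $ i $ j = 0" using 0 by simp
    then show "b $ j = ((b $ i / a $ i) *s a) $ j"
      using i by (simp add: pluecker_def field_simps)
  qed
  then show "b \<in> vec.span {a}" by (auto simp: vec.span_singleton)
next
  assume "b \<in> vec.span {a}"
  then show "pluecker a b = 0"
    by (auto simp: vec.span_singleton pluecker_def vec_eq_iff algebra_simps)
qed

lemma pluecker_0_left [simp]: "pluecker 0 b = 0"
  by (simp add: pluecker_def vec_eq_iff)

lemma dim_span_pluecker:
  fixes a b :: "'a::field ^ 'd::finite"
  assumes "pluecker a b \<noteq> 0"
  shows "vec.dim (vec.span {a, b}) = 2"
proof -
  have "a \<noteq> 0" using assms by auto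
  moreover have "b \<notin> vec.span {a}" using assms calculation pluecker_eq_0_iff by blast
  ultimately have "vec.dim {b, a} = 2"
    by (subst vec.dim_insert) auto
  then show ?thesis by (simp add: insert_commute)
qed

lemma span_eq_line:
  fixes L :: "('a::field ^ 'd::finite) set"
  assumes "L \<in> proj_lines" "a \<in> L" "b \<in> L" "pluecker a b \<noteq> 0"
  shows "vec.span {a, b} = L"
proof -
  have L: "vec.subspace L" "vec.dim L = 2" using assms(1) by (auto simp: proj_lines_def)
  have "vec.span {a, b} \<subseteq> L" using assms L by (intro vec.span_minimal) auto
  then show ?thesis
    using L dim_span_pluecker[OF assms(4)] by (intro vec.subspace_dim_equal) auto
qed

text \<open>One-dimensional subspaces are equal as soon as one contains the other, so minors test
  whether two points coincide.\<close>

lemma span_singleton_eq_iff: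
  fixes a b :: "'a::field ^ 'd::finite"
  assumes "a \<noteq> 0" "b \<noteq> 0"
  shows "vec.span {a} = vec.span {b} \<longleftrightarrow> pluecker a b = 0"
proof -
  have "vec.span {b} = vec.span {a}" if "b \<in> vec.span {a}"
    using that assms by (intro vec.subspace_dim_equal vec.span_minimal) auto
  then show ?thesis using assms vec.span_base[of b "{b}"] by (auto simp: pluecker_eq_0_iff)
qed

lemma proj_point_generator:
  fixes p :: "('a::field ^ 'd::finite) set"
  assumes "p \<in> proj_points"
  shows "\<exists>a. a \<noteq> 0 \<and> vec.span {a} = p"
proof -
  have s: "vec.subspace p" "vec.dim p = 1" using assms by (auto simp: proj_points_def)
  then obtain a where a: "a \<in> p" "a \<noteq> 0"
    by (metis vec.dim_eq_0 subsetI singletonI singleton_iff zero_neq_one)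
  have "vec.span {a} = p"
    using a s by (intro vec.subspace_dim_equal vec.span_minimal) auto
  with a show ?thesis by blast
qed

lemma proj_point_generator_nonzero:
  assumes "vec.span {a} \<in> proj_points"
  shows "a \<noteq> 0"
  using assms by (auto simp: proj_points_def)

lemma proj_line_extend:
  fixes L :: "('a::field ^ 'd::finite) set"
  assumes "L \<in> proj_lines" "a \<in> L" "a \<noteq> 0"
  shows "\<exists>b. pluecker a b \<noteq> 0 \<and> vec.span {a, b} = L"
proof -
  have L: "vec.subspace L" "vec.dim L = 2" using assms(1) by (auto simp: proj_lines_def)
  have "\<not> L \<subseteq> vec.span {a}"
  proof
    assume "L \<subseteq> vec.span {a}"
    from vec.dim_mono[OF this] show False using L assms(3) by simp
  qed
  then obtain b where "b \<in> L" "pluecker a b \<noteq> 0"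
    using pluecker_eq_0_iff[OF assms(3)] by blast
  then show ?thesis using span_eq_line assms by blast
qed

section \<open>Coordinates of cellules\<close>

abbreviation same_block :: "'v set set \<Rightarrow> 'v \<Rightarrow> 'v \<Rightarrow> bool" where
  "same_block \<sigma> v w \<equiv> \<exists>B\<in>\<sigma>. v \<in> B \<and> w \<in> B"

text \<open>An edge \<open>e\<close> is oriented from \<open>Min e\<close> to \<open>Max e\<close>, and \<open>y e\<close> is a second generator of its
  line besides \<open>x (Min e)\<close>: it is free exactly where the two endpoints coincide.\<close>

definition frame ::
    "'v::linorder set \<Rightarrow> ('v \<Rightarrow> 'a::field ^ 'd) \<Rightarrow> ('v set \<Rightarrow> 'a ^ 'd) \<Rightarrow> bool" where
  "frame V x y \<longleftrightarrow> (\<forall>v\<in>V. x v \<noteq> 0) \<and>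
     (\<forall>e\<in>complete_edges V. pluecker (x (Min e)) (y e) \<noteq> 0 \<and>
        x (Max e) \<in> vec.span {x (Min e), y e})"

definition pic ::
    "'v::linorder set \<Rightarrow> ('v \<Rightarrow> 'a::field ^ 'd) \<Rightarrow> ('v set \<Rightarrow> 'a ^ 'd) \<Rightarrow> ('a, 'd, 'v) picture" where
  "pic V x y = (\<lambda>v\<in>V. vec.span {x v}, \<lambda>e\<in>complete_edges V. vec.span {x (Min e), y e})"

definition coords ::
    "('v::linorder \<Rightarrow> 'a::field ^ 'd) \<Rightarrow> ('v set \<Rightarrow> 'a ^ 'd) \<Rightarrow> 'v set \<Rightarrow> 'a ^ 'd ^ 'd" where
  "coords x y e = pluecker (x (Min e)) (y e)"

lemma complete_edges_cases:
  fixes e :: "'v::linorder set"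
  assumes "e \<in> complete_edges V"
  shows "Min e \<in> V" "Max e \<in> V" "Min e < Max e" "e = {Min e, Max e}"
proof -
  have "card e = 2" "e \<subseteq> V" using assms by (auto simp: complete_edges_def)
  then obtain a b where "e = {a, b}" "a \<noteq> b" by (auto simp: card_2_iff)
  with \<open>e \<subseteq> V\<close> show "Min e \<in> V" "Max e \<in> V" "Min e < Max e" "e = {Min e, Max e}"
    by (auto simp: min_def max_def)
qed

lemma complete_edgesI: "v \<in> V \<Longrightarrow> w \<in> V \<Longrightarrow> v \<noteq> w \<Longrightarrow> {v, w} \<in> complete_edges V"
  by (auto simp: complete_edges_def)

lemma finite_complete_edges: "finite V \<Longrightarrow> finite (complete_edges V)"
  by (simp add: complete_edges_def)

lemma hom_coords_pic:
  "hom_coords V (complete_edges V) (pic V x y) x (coords x y)"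
  unfolding hom_coords_def pic_def coords_def by auto

lemma frame_pic_picture_space:
  fixes x :: "'v::linorder \<Rightarrow> 'a::field ^ 'd::finite"
  assumes "frame V x y"
  shows "pic V x y \<in> picture_space V (complete_edges V)"
proof -
  have "fst (pic V x y) v \<subseteq> snd (pic V x y) e" if e: "e \<in> complete_edges V" and v: "v \<in> e" for e v
  proof -
    have "v = Min e \<or> v = Max e" using complete_edges_cases(4)[OF e] v by blast
    moreover have "v \<in> V" using e v by (auto simp: complete_edges_def)
    moreover have "x v \<in> vec.span {x (Min e), y e}"
      using assms e calculation(1) by (auto simp: frame_def intro: vec.span_base)
    ultimately show ?thesis using e by (simp add: pic_def vec.span_minimal)
  qed
  moreover have "pic V x y \<in> ambient V (complete_edges V)"
    using assms
    by (auto simp: ambient_def pic_def proj_points_def proj_lines_def frame_def dim_span_pluecker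
        simp del: vec.dim_span) (auto simp: vec.dim_span)
  ultimately show ?thesis by (simp add: picture_space_def)
qed

lemma frame_pic_cellule:
  fixes x :: "'v::linorder \<Rightarrow> 'a::field ^ 'd::finite"
  assumes "frame V x y"
    and "\<And>v w. v \<in> V \<Longrightarrow> w \<in> V \<Longrightarrow> same_block \<sigma> v w \<Longrightarrow> x v = x w"
    and "\<And>v w. v \<in> V \<Longrightarrow> w \<in> V \<Longrightarrow> \<not> same_block \<sigma> v w \<Longrightarrow> pluecker (x v) (x w) \<noteq> 0"
  shows "pic V x y \<in> cellule V (complete_edges V) \<sigma>"
proof -
  have "(fst (pic V x y) v = fst (pic V x y) w) = same_block \<sigma> v w" if vw: "v \<in> V" "w \<in> V" for v w
  proof -
    have "x v \<noteq> 0" "x w \<noteq> 0" using assms(1) vw by (auto simp: frame_def)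
    then have "(fst (pic V x y) v = fst (pic V x y) w) = (pluecker (x v) (x w) = 0)"
      using vw by (simp add: pic_def span_singleton_eq_iff)
    moreover have "pluecker a a = 0" for a :: "'a ^ 'd" by (simp add: pluecker_def vec_eq_iff)
    ultimately show ?thesis using assms(2)[OF vw] assms(3)[OF vw] by metis
  qed
  then show ?thesis using frame_pic_picture_space[OF assms(1)] by (simp add: cellule_def)
qed

text \<open>The equations on \<open>x\<close> and \<open>y\<close> are linear, so affine
  combinations of two such pairs satisfy them again. They imply the incidences; everything else is a
  nonvanishing condition.\<close>

definition cell_frame :: "'v::linorder set \<Rightarrow> 'v set set \<Rightarrow> ('v \<Rightarrow> 'a::field ^ 'd)
    \<Rightarrow> ('v set \<Rightarrow> 'a ^ 'd) \<Rightarrow> bool" where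
  "cell_frame V \<sigma> x y \<longleftrightarrow> frame V x y \<and>
     (\<forall>v\<in>V. \<forall>w\<in>V. same_block \<sigma> v w \<longrightarrow> x v = x w) \<and>
     (\<forall>v\<in>V. \<forall>w\<in>V. \<not> same_block \<sigma> v w \<longrightarrow> pluecker (x v) (x w) \<noteq> 0) \<and>
     (\<forall>e\<in>complete_edges V. \<not> same_block \<sigma> (Min e) (Max e) \<longrightarrow> y e = x (Max e))"

lemma cell_frameD:
  assumes "cell_frame V \<sigma> x y"
  shows "frame V x y"
    and "v \<in> V \<Longrightarrow> w \<in> V \<Longrightarrow> same_block \<sigma> v w \<Longrightarrow> x v = x w"
    and "v \<in> V \<Longrightarrow> w \<in> V \<Longrightarrow> \<not> same_block \<sigma> v w \<Longrightarrow> pluecker (x v) (x w) \<noteq> 0"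
    and "e \<in> complete_edges V \<Longrightarrow> \<not> same_block \<sigma> (Min e) (Max e) \<Longrightarrow> y e = x (Max e)"
  using assms unfolding cell_frame_def by simp_all

text \<open>This parametrizes the whole cellule, so that two arbitrary pictures in it can be
  interpolated coordinate by coordinate.\<close>

lemma cellule_frame:
  fixes P :: "('a::field, 'd::finite, 'v::linorder) picture"
  assumes P: "P \<in> cellule V (complete_edges V) \<sigma>"
  shows "\<exists>x y. cell_frame V \<sigma> x y \<and> P = pic V x y"
proof -
  let ?E = "complete_edges V"
  have PS: "P \<in> ambient V ?E" "\<And>e v. e \<in> ?E \<Longrightarrow> v \<in> e \<Longrightarrow> fst P v \<subseteq> snd P e"
    and eq: "\<And>v w. v \<in> V \<Longrightarrow> w \<in> V \<Longrightarrow> fst P v = fst P w \<longleftrightarrow> same_block \<sigma> v w"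
    using P by (auto simp: cellule_def picture_space_def)
  have pt: "fst P v \<in> proj_points" if "v \<in> V" for v
    using PS(1) that by (auto simp: ambient_def)
  have ln: "snd P e \<in> proj_lines" if "e \<in> ?E" for e
    using PS(1) that by (auto simp: ambient_def)
  \<comment> \<open>\<open>g\<close> depends only on the subspace, so vertices at the same point
    receive the same vector and not merely proportional ones.\<close>
  obtain g :: "('a ^ 'd) set \<Rightarrow> 'a ^ 'd" where
    g: "\<And>p. p \<in> proj_points \<Longrightarrow> g p \<noteq> 0 \<and> vec.span {g p} = p"
    using proj_point_generator by metis
  define x where "x v = g (fst P v)" for v
  have x: "x v \<noteq> 0" "vec.span {x v} = fst P v" if "v \<in> V" for v
    using g pt[OF that] by (auto simp: x_def)
  have same: "x v = x w" if "v \<in> V" "w \<in> V" "same_block \<sigma> v w" for v w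
    using eq[OF that(1,2)] that(3) by (simp add: x_def)
  have diff: "pluecker (x v) (x w) \<noteq> 0" if "v \<in> V" "w \<in> V" "\<not> same_block \<sigma> v w" for v w
    using eq[OF that(1,2)] that span_singleton_eq_iff[of "x v" "x w"] x by metis
  have inc: "x v \<in> snd P e" if "e \<in> ?E" "v \<in> e" for e v
  proof -
    have "v \<in> V" using that by (auto simp: complete_edges_def)
    then show ?thesis using x(2) PS(2)[OF that] vec.span_base[of "x v" "{x v}"] by auto
  qed
  have "\<exists>b. pluecker (x (Min e)) b \<noteq> 0 \<and> vec.span {x (Min e), b} = snd P e \<and>
      (\<not> same_block \<sigma> (Min e) (Max e) \<longrightarrow> b = x (Max e))" if e: "e \<in> ?E" for e
  proof -
    note ec = complete_edges_cases[OF e]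
    have in1: "x (Min e) \<in> snd P e" and in2: "x (Max e) \<in> snd P e"
      using inc[OF e] ec(4) by (metis insertCI)+
    show ?thesis
    \<comment> \<open>Coinciding endpoints leave the line free, and any second generator will do;
      distinct endpoints already span it.\<close>
    proof (cases "same_block \<sigma> (Min e) (Max e)")
      case True
      then show ?thesis using proj_line_extend[OF ln[OF e] in1] x(1)[OF ec(1)] by blast
    next
      case False
      then show ?thesis using diff[OF ec(1,2)] span_eq_line[OF ln[OF e] in1 in2] by blast
    qed
  qed
  then have "\<forall>e\<in>?E. \<exists>b. pluecker (x (Min e)) b \<noteq> 0 \<and> vec.span {x (Min e), b} = snd P e \<and>
      (\<not> same_block \<sigma> (Min e) (Max e) \<longrightarrow> b = x (Max e))" by blast
  from bchoice[OF this] obtain y where y': "\<forall>e\<in>?E. pluecker (x (Min e)) (y e) \<noteq> 0 \<and>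
      vec.span {x (Min e), y e} = snd P e \<and>
      (\<not> same_block \<sigma> (Min e) (Max e) \<longrightarrow> y e = x (Max e))" ..
  have y: "pluecker (x (Min e)) (y e) \<noteq> 0" "vec.span {x (Min e), y e} = snd P e"
    "\<not> same_block \<sigma> (Min e) (Max e) \<Longrightarrow> y e = x (Max e)" if "e \<in> ?E" for e
    using bspec[OF y' that] by simp_all
  have "x (Max e) \<in> vec.span {x (Min e), y e}" if "e \<in> ?E" for e
    using inc[OF that] complete_edges_cases(4)[OF that] y(2)[OF that] by (metis insertCI)
  then have "frame V x y" using x(1) y(1) by (simp add: frame_def)
  moreover have "P = pic V x y"
  proof -
    have "fst P = (\<lambda>v\<in>V. vec.span {x v})"
      using PS(1) x(2) by (intro ext) (auto simp: ambient_def PiE_def extensional_def)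
    moreover have "snd P = (\<lambda>e\<in>?E. vec.span {x (Min e), y e})"
      using PS(1) y(2) by (intro ext) (auto simp: ambient_def PiE_def extensional_def)
    ultimately show ?thesis by (simp add: pic_def prod_eq_iff)
  qed
  moreover have "y e = x (Max e)" if "e \<in> ?E" "\<not> same_block \<sigma> (Min e) (Max e)" for e
    using y(3) that by simp
  ultimately have "cell_frame V \<sigma> x y \<and> P = pic V x y"
    unfolding cell_frame_def using same diff by simp
  then show ?thesis by blast
qed

text \<open>Each open condition has to hold at one parameter only, which may depend on the
  condition: it then fails at finitely many, and finiteness of \<open>V\<close> leaves finitely many
  conditions. Incidences and coincidences are required at every parameter.\<close>

lemma curve_generic:
  fixes x :: "'a::field \<Rightarrow> 'v::linorder \<Rightarrow> 'a ^ 'd::finite"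
  assumes V: "finite V"
    and px: "\<And>v i. polyfun (\<lambda>t. x t v $ i)" and py: "\<And>e i. polyfun (\<lambda>t. y t e $ i)"
    and nz: "\<And>v. v \<in> V \<Longrightarrow> \<exists>t. x t v \<noteq> 0"
    and ln: "\<And>e. e \<in> complete_edges V \<Longrightarrow> \<exists>t. pluecker (x t (Min e)) (y t e) \<noteq> 0"
    and inc: "\<And>e t. e \<in> complete_edges V \<Longrightarrow> x t (Max e) \<in> vec.span {x t (Min e), y t e}"
    and same: "\<And>v w t. v \<in> V \<Longrightarrow> w \<in> V \<Longrightarrow> same_block \<sigma> v w \<Longrightarrow> x t v = x t w"
    and diff: "\<And>v w. v \<in> V \<Longrightarrow> w \<in> V \<Longrightarrow> \<not> same_block \<sigma> v w
      \<Longrightarrow> \<exists>t. pluecker (x t v) (x t w) \<noteq> 0"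
  shows "finite {t. pic V (x t) (y t) \<notin> cellule V (complete_edges V) \<sigma>}"
proof -
  let ?E = "complete_edges V"
  \<comment> \<open>\<open>Z\<close> collects the parameters at which some open condition
    fails.\<close>
  define Z where "Z = (\<Union>v\<in>V. {t. x t v = 0}) \<union>
    (\<Union>e\<in>?E. {t. pluecker (x t (Min e)) (y t e) = 0}) \<union>
    (\<Union>(v, w)\<in>{(v, w)\<in>V \<times> V. \<not> same_block \<sigma> v w}. {t. pluecker (x t v) (x t w) = 0})"
  have "finite {t. x t v = 0}" if "v \<in> V" for v
    using nz[OF that] px polyfun_finite_zeros_vec[of "\<lambda>t. x t v"] by blast
  moreover have "finite {t. pluecker (x t (Min e)) (y t e) = 0}" if "e \<in> ?E" for e
    using ln[OF that] px py finite_pluecker_zeros[of "\<lambda>t. x t (Min e)" "\<lambda>t. y t e"] by blast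
  moreover have "finite {t. pluecker (x t v) (x t w) = 0}"
    if "v \<in> V" "w \<in> V" "\<not> same_block \<sigma> v w" for v w
    using diff[OF that] px finite_pluecker_zeros[of "\<lambda>t. x t v" "\<lambda>t. x t w"] by blast
  moreover have "finite {(v, w)\<in>V \<times> V. \<not> same_block \<sigma> v w}"
    by (rule finite_subset[of _ "V \<times> V"]) (use V in auto)
  ultimately have "finite Z"
    unfolding Z_def using V finite_complete_edges[OF V]
    by (intro finite_UnI finite_UN_I) auto
  moreover have "{t. pic V (x t) (y t) \<notin> cellule V ?E \<sigma>} \<subseteq> Z"
  proof (rule subsetI, rule ccontr)
    fix t assume t: "t \<in> {t. pic V (x t) (y t) \<notin> cellule V ?E \<sigma>}" "t \<notin> Z"
    have "frame V (x t) (y t)" using t(2) inc by (auto simp: frame_def Z_def)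
    moreover have "pluecker (x t v) (x t w) \<noteq> 0"
      if "v \<in> V" "w \<in> V" "\<not> same_block \<sigma> v w" for v w
    proof
      assume "pluecker (x t v) (x t w) = 0"
      then have "t \<in> Z" using that unfolding Z_def by blast
      then show False using t(2) by blast
    qed
    ultimately have "pic V (x t) (y t) \<in> cellule V ?E \<sigma>"
      by (intro frame_pic_cellule same)
    then show False using t(1) by blast
  qed
  ultimately show ?thesis by (rule rev_finite_subset)
qed

section \<open>Closures and irreducibility\<close>

lemma topspace_picture_topology: "topspace (picture_topology V E) = picture_space V E"
  by (auto simp: picture_topology_def topspace_zariski picture_space_def)

text \<open>Quantifying over all coordinates makes this a property of the picture alone; it is the
  condition that one member of \<open>F\<close> imposes in \<open>zero_locus\<close>.\<close>

definition vanishes :: "'v set \<Rightarrow> 'v set set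
    \<Rightarrow> (('v \<Rightarrow> 'a::field ^ 'd) \<Rightarrow> ('v set \<Rightarrow> 'a ^ 'd ^ 'd) \<Rightarrow> 'a) \<Rightarrow> ('a, 'd, 'v) picture \<Rightarrow> bool" where
  "vanishes V E f P \<longleftrightarrow> (\<forall>x p. hom_coords V E P x p \<longrightarrow> f x p = 0)"

lemma vanishes_iff:
  assumes "multihom V E m f" "hom_coords V E P x p"
  shows "vanishes V E f P \<longleftrightarrow> f x p = 0"
  using multihom_zero_indep[OF assms(1)] assms(2) unfolding vanishes_def by blast

lemma vanishes_pic:
  assumes "multihom V (complete_edges V) m f"
  shows "vanishes V (complete_edges V) f (pic V x y) \<longleftrightarrow> f x (coords x y) = 0"
  by (rule vanishes_iff[OF assms hom_coords_pic])

text \<open>A closed set is the trace of a zero locus, so a picture outside it violates one of the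
  defining polynomials.\<close>

lemma closedin_picture_separate:
  assumes "closedin (picture_topology V E) A" "P \<in> picture_space V E" "P \<notin> A"
  shows "\<exists>m f. multihom V E m f \<and> \<not> vanishes V E f P \<and> (\<forall>Q\<in>A. vanishes V E f Q)"
proof -
  obtain T where T: "zariski_closed V E T" "A = T \<inter> picture_space V E"
    using assms(1) by (auto simp: picture_topology_def closedin_subtopology closedin_zariski)
  then obtain F where F: "\<And>f. f \<in> F \<Longrightarrow> \<exists>m. multihom V E m f" "T = zero_locus V E F"
    by (auto simp: zariski_closed_def)
  have "P \<in> ambient V E" "P \<notin> zero_locus V E F"
    using assms(2,3) T(2) F(2) by (auto simp: picture_space_def)
  then obtain f where f: "f \<in> F" "\<not> vanishes V E f P"
    by (auto simp: zero_locus_def vanishes_def)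
  moreover have "vanishes V E f Q" if "Q \<in> A" for Q
    using that f(1) unfolding T(2) F(2) zero_locus_def vanishes_def by blast
  ultimately show ?thesis using F(1) by blast
qed

lemma closedin_vanishing:
  assumes "multihom V E m f"
  shows "closedin (picture_topology V E) {P \<in> picture_space V E. vanishes V E f P}"
proof -
  have "zariski_closed V E (zero_locus V E {f})"
    using assms unfolding zariski_closed_def by blast
  moreover have "{P \<in> picture_space V E. vanishes V E f P} = zero_locus V E {f} \<inter> picture_space V E"
    by (auto simp: zero_locus_def picture_space_def vanishes_def)
  ultimately show ?thesis
    by (auto simp: picture_topology_def closedin_subtopology closedin_zariski)
qed

lemma vanishes_on_closure:
  assumes "multihom V E m f" "S \<subseteq> picture_space V E" "\<And>Q. Q \<in> S \<Longrightarrow> vanishes V E f Q"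
    and "P \<in> picture_topology V E closure_of S"
  shows "vanishes V E f P"
proof -
  have "picture_topology V E closure_of S \<subseteq> {P \<in> picture_space V E. vanishes V E f P}"
    by (rule closure_of_minimal[OF _ closedin_vanishing[OF assms(1)]]) (use assms(2,3) in blast)
  then show ?thesis using assms(4) by blast
qed

lemma cellule_subset: "cellule V E \<sigma> \<subseteq> picture_space V E"
  by (auto simp: cellule_def)

lemma polyfun_coords:
  assumes "\<And>v i. polyfun (\<lambda>t. x t v $ i)" "\<And>e i. polyfun (\<lambda>t. y t e $ i)"
    and "multihom V E m f"
  shows "polyfun (\<lambda>t. f (x t) (coords (x t) (y t)))"
  by (rule polyfun_multihom[OF assms(3)]) (auto simp: coords_def intro!: polyfun_pluecker assms)

text \<open>Otherwise some \<open>f\<close> vanishes on the closure but not at \<open>t0\<close>.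
  Along the curve \<open>f\<close> then has finitely many zeros, so in an infinite field some other
  parameter gives a picture in \<open>S\<close> where \<open>f\<close> is nonzero.\<close>

lemma curve_limit_in_closure:
  fixes x :: "'a::field \<Rightarrow> 'v::linorder \<Rightarrow> 'a ^ 'd::finite"
  assumes inf: "infinite (UNIV :: 'a set)"
    and px: "\<And>v i. polyfun (\<lambda>t. x t v $ i)" and py: "\<And>e i. polyfun (\<lambda>t. y t e $ i)"
    and S: "S \<subseteq> picture_space V (complete_edges V)"
    and fin: "finite {t. pic V (x t) (y t) \<notin> S}"
    and t0: "pic V (x t0) (y t0) \<in> picture_space V (complete_edges V)"
  shows "pic V (x t0) (y t0) \<in> picture_topology V (complete_edges V) closure_of S"
proof (rule ccontr)
  let ?E = "complete_edges V"
  assume *: "pic V (x t0) (y t0) \<notin> picture_topology V ?E closure_of S"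
  obtain m f where f: "multihom V ?E m f" "\<not> vanishes V ?E f (pic V (x t0) (y t0))"
    "\<And>Q. Q \<in> picture_topology V ?E closure_of S \<Longrightarrow> vanishes V ?E f Q"
    using closedin_picture_separate[OF closedin_closure_of t0 *] by blast
  have "finite {t. f (x t) (coords (x t) (y t)) = 0}"
    using polyfun_coords[OF px py f(1)] f(2)[unfolded vanishes_pic[OF f(1)]]
    by (rule polyfun_finite_zeros)
  with fin obtain t where t: "pic V (x t) (y t) \<in> S" "f (x t) (coords (x t) (y t)) \<noteq> 0"
    using inf ex_new_if_finite[of "{t. pic V (x t) (y t) \<notin> S} \<union> {t. f (x t) (coords (x t) (y t)) = 0}"]
    by auto
  have "S \<subseteq> picture_topology V ?E closure_of S"
    by (rule closure_of_subset) (simp add: topspace_picture_topology S)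
  then show False using f(3) vanishes_pic[OF f(1)] t by blast
qed

text \<open>For proper closed subsets \<open>A\<close> and \<open>B\<close> covering the cellule,
  take \<open>P\<close> outside \<open>A\<close> and \<open>Q\<close> outside \<open>B\<close>, with
  separating polynomials \<open>f\<close> and \<open>g\<close>. On the line joining their
  coordinates, all but finitely many parameters give a picture of the cellule where neither
  polynomial vanishes.\<close>

lemma irreducible_cellule:
  fixes \<sigma> :: "'v::linorder set set"
  assumes inf: "infinite (UNIV :: 'a::field set)" and V: "finite V"
    and ne: "cellule V (complete_edges V) \<sigma> \<noteq> ({} :: ('a, 'd::finite, 'v) picture set)"
  shows "irreducible_in (picture_topology V (complete_edges V))
    (cellule V (complete_edges V) \<sigma> :: ('a, 'd, 'v) picture set)"
proof -
  let ?E = "complete_edges V"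
  let ?X = "picture_topology V ?E :: ('a, 'd, 'v) picture topology"
  let ?S = "cellule V ?E \<sigma> :: ('a, 'd, 'v) picture set"
  have top: "topspace (subtopology ?X ?S) = ?S"
    using cellule_subset by (auto simp: topspace_picture_topology)
  have "A = ?S \<or> B = ?S"
    if A: "closedin (subtopology ?X ?S) A" and B: "closedin (subtopology ?X ?S) B"
      and AB: "A \<union> B = ?S" for A B
  proof (rule ccontr)
    assume *: "\<not> (A = ?S \<or> B = ?S)"
    obtain A' B' where A': "closedin ?X A'" "A = A' \<inter> ?S" and B': "closedin ?X B'" "B = B' \<inter> ?S"
      using A B by (auto simp: closedin_subtopology)
    obtain P Q where P: "P \<in> ?S" "P \<notin> A'" and Q: "Q \<in> ?S" "Q \<notin> B'"
      using * A'(2) B'(2) AB by blast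
    have PQ: "P \<in> picture_space V ?E" "Q \<in> picture_space V ?E"
      using P(1) Q(1) cellule_subset by blast+
    obtain x0 y0 where 0: "cell_frame V \<sigma> x0 y0" "P = pic V x0 y0"
      using cellule_frame[OF P(1)] by blast
    obtain x1 y1 where 1: "cell_frame V \<sigma> x1 y1" "Q = pic V x1 y1"
      using cellule_frame[OF Q(1)] by blast
    obtain m f where f: "multihom V ?E m f" "\<not> vanishes V ?E f P"
      "\<And>Q. Q \<in> A' \<Longrightarrow> vanishes V ?E f Q"
      using closedin_picture_separate[OF A'(1) PQ(1) P(2)] by blast
    obtain m' g where g: "multihom V ?E m' g" "\<not> vanishes V ?E g Q"
      "\<And>Q. Q \<in> B' \<Longrightarrow> vanishes V ?E g Q"
      using closedin_picture_separate[OF B'(1) PQ(2) Q(2)] by blast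
    \<comment> \<open>The curve passes through \<open>P\<close> at \<open>t = 0\<close>, where
      \<open>f\<close> is nonzero, and through \<open>Q\<close> at \<open>t = 1\<close>, where
      \<open>g\<close> is nonzero.\<close>
    define x where "x t v = x0 v + t *s (x1 v - x0 v)" for t v
    define y where "y t e = y0 e + t *s (y1 e - y0 e)" for t e
    have x01: "x 0 = x0" "y 0 = y0" "x 1 = x1" "y 1 = y1" by (auto simp: x_def y_def)
    have px: "polyfun (\<lambda>t. x t v $ i)" for v i
      by (simp add: x_def) (intro polyfun_add polyfun_diff polyfun_mult polyfun_const polyfun_id)
    have py: "polyfun (\<lambda>t. y t e $ i)" for e i
      by (simp add: y_def) (intro polyfun_add polyfun_diff polyfun_mult polyfun_const polyfun_id)
    have "finite {t. pic V (x t) (y t) \<notin> ?S}"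
    proof (rule curve_generic[OF V px py])
      show "\<exists>t. x t v \<noteq> 0" if "v \<in> V" for v
        using cell_frameD(1)[OF 0(1)] x01 that unfolding frame_def by metis
      show "\<exists>t. pluecker (x t (Min e)) (y t e) \<noteq> 0" if "e \<in> ?E" for e
        using cell_frameD(1)[OF 0(1)] x01 that unfolding frame_def by metis
      show "\<exists>t. pluecker (x t v) (x t w) \<noteq> 0"
        if "v \<in> V" "w \<in> V" "\<not> same_block \<sigma> v w" for v w
        using cell_frameD(3)[OF 0(1) that] x01 by metis
      show same: "x t v = x t w" if "v \<in> V" "w \<in> V" "same_block \<sigma> v w" for v w t
        using cell_frameD(2)[OF 0(1) that] cell_frameD(2)[OF 1(1) that] by (simp add: x_def)
      \<comment> \<open>Incidence by itself is not linear in the pair \<open>x\<close>,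
        \<open>y\<close>; it survives interpolation because both frames satisfy the same linear
        equation at \<open>e\<close>.\<close>
      show "x t (Max e) \<in> vec.span {x t (Min e), y t e}" if e: "e \<in> ?E" for e t
      proof (cases "same_block \<sigma> (Min e) (Max e)")
        case True
        then have "x t (Max e) = x t (Min e)" using same complete_edges_cases[OF e] by metis
        then show ?thesis by (simp add: vec.span_base)
      next
        case False
        then have "x t (Max e) = y t e" using cell_frameD(4)[OF 0(1) e] cell_frameD(4)[OF 1(1) e]
          by (simp add: x_def y_def)
        then show ?thesis by (simp add: vec.span_base)
      qed
    qed
    moreover have "finite {t. f (x t) (coords (x t) (y t)) = 0}"
      using polyfun_coords[OF px py f(1)] f(2)[unfolded 0(2) vanishes_pic[OF f(1)]]
      by (intro polyfun_finite_zeros[of _ 0]) (auto simp: x01)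
    moreover have "finite {t. g (x t) (coords (x t) (y t)) = 0}"
      using polyfun_coords[OF px py g(1)] g(2)[unfolded 1(2) vanishes_pic[OF g(1)]]
      by (intro polyfun_finite_zeros[of _ 1]) (auto simp: x01)
    ultimately have "finite ({t. pic V (x t) (y t) \<notin> ?S} \<union>
        {t. f (x t) (coords (x t) (y t)) = 0} \<union> {t. g (x t) (coords (x t) (y t)) = 0})"
      by blast
    from ex_new_if_finite[OF inf this] obtain t where t: "pic V (x t) (y t) \<in> ?S"
      "f (x t) (coords (x t) (y t)) \<noteq> 0" "g (x t) (coords (x t) (y t)) \<noteq> 0" by auto
    have "pic V (x t) (y t) \<notin> A'" using f(3) vanishes_pic[OF f(1)] t(2) by blast
    moreover have "pic V (x t) (y t) \<notin> B'" using g(3) vanishes_pic[OF g(1)] t(3) by blast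
    ultimately show False using t(1) AB A'(2) B'(2) by blast
  qed
  then have "irreducible_space (subtopology ?X ?S)"
    using ne unfolding irreducible_space_def top by simp
  then show ?thesis by (simp add: irreducible_in_def topspace_picture_topology cellule_subset)
qed

section \<open>Irreducible subsets of a general topological space\<close>

lemma irreducible_in_closure_of:
  assumes "irreducible_in X S"
  shows "irreducible_in X (X closure_of S)"
proof -
  let ?C = "X closure_of S"
  have S: "S \<subseteq> topspace X" "irreducible_space (subtopology X S)"
    using assms by (auto simp: irreducible_in_def)
  have topS: "topspace (subtopology X S) = S" and topC: "topspace (subtopology X ?C) = ?C"
    using S(1) closure_of_subset_topspace[of X S] by auto
  have sub: "S \<subseteq> ?C" by (rule closure_of_subset[OF S(1)])
  have "A = ?C \<or> B = ?C"
    if A: "closedin (subtopology X ?C) A" and B: "closedin (subtopology X ?C) B"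
      and AB: "A \<union> B = ?C" for A B
  proof -
    have cl: "closedin X A" "closedin X B"
      using A B closedin_trans_full closedin_closure_of by blast+
    then have "closedin (subtopology X S) (A \<inter> S)" "closedin (subtopology X S) (B \<inter> S)"
      by (auto simp: closedin_subtopology)
    moreover have "A \<inter> S \<union> B \<inter> S = S" using AB sub by blast
    ultimately have "A \<inter> S = S \<or> B \<inter> S = S"
      using S(2) unfolding irreducible_space_def topS by blast
    then have "?C \<subseteq> A \<or> ?C \<subseteq> B" using closure_of_minimal cl by (metis inf.absorb_iff2)
    then show ?thesis using AB by blast
  qed
  moreover have "?C \<noteq> {}" using S(2) sub unfolding irreducible_space_def topS by blast
  ultimately have "irreducible_space (subtopology X ?C)"
    unfolding irreducible_space_def topC by simp
  then show ?thesis by (simp add: irreducible_in_def closure_of_subset_topspace)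
qed

text \<open>Induction on the family: irreducibility decides between \<open>C\<close> and the union
  of the remaining members, which is closed.\<close>

lemma irreducible_in_subset_Union:
  assumes "finite \<C>" "\<And>C. C \<in> \<C> \<Longrightarrow> closedin X C" "irreducible_in X S" "S \<subseteq> \<Union>\<C>"
  shows "\<exists>C\<in>\<C>. S \<subseteq> C"
  using assms(1,2,4)
proof (induction \<C>)
  case empty
  then show ?case using assms(3) by (auto simp: irreducible_in_def irreducible_space_def)
next
  case (insert C \<C>)
  have S: "S \<subseteq> topspace X" "irreducible_space (subtopology X S)"
    using assms(3) by (auto simp: irreducible_in_def)
  then have topS: "topspace (subtopology X S) = S" by auto
  have "closedin X (\<Union>\<C>)" using insert by (intro closedin_Union) auto
  then have "closedin (subtopology X S) (C \<inter> S)" "closedin (subtopology X S) (\<Union>\<C> \<inter> S)"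
    using insert.prems(1) by (auto simp: closedin_subtopology)
  moreover have "C \<inter> S \<union> \<Union>\<C> \<inter> S = S" using insert.prems(2) by auto
  ultimately have "C \<inter> S = S \<or> \<Union>\<C> \<inter> S = S"
    using S(2) unfolding irreducible_space_def topS by blast
  then show ?case
  proof
    assume "\<Union>\<C> \<inter> S = S"
    then have "\<exists>C\<in>\<C>. S \<subseteq> C" using insert by blast
    then show ?thesis by blast
  qed blast
qed

text \<open>Every irreducible set lies in some member of \<open>\<C>\<close>, so a maximal one is a
  member. An irreducible set containing a member \<open>C\<close> lies in a member \<open>D\<close>,
  and \<open>anti\<close> gives \<open>C = D\<close>.\<close>

lemma irreducible_components_eq:
  assumes fin: "finite \<C>" and closed: "\<And>C. C \<in> \<C> \<Longrightarrow> closedin X C"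
    and irr: "\<And>C. C \<in> \<C> \<Longrightarrow> irreducible_in X C" and cover: "topspace X \<subseteq> \<Union>\<C>"
    and anti: "\<And>C D. C \<in> \<C> \<Longrightarrow> D \<in> \<C> \<Longrightarrow> C \<subseteq> D \<Longrightarrow> C = D"
  shows "irreducible_components X = \<C>"
proof -
  have sub: "\<exists>C\<in>\<C>. S \<subseteq> C" if S: "irreducible_in X S" for S
  proof (rule irreducible_in_subset_Union[OF fin closed S])
    show "S \<subseteq> \<Union>\<C>" using S cover by (auto simp: irreducible_in_def)
  qed
  show ?thesis
  proof (intro equalityI subsetI)
    fix S assume S: "S \<in> irreducible_components X"
    then have S: "irreducible_in X S" "\<And>T. irreducible_in X T \<Longrightarrow> S \<subseteq> T \<Longrightarrow> T = S"
      by (simp_all add: irreducible_components_def)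
    obtain C where C: "C \<in> \<C>" "S \<subseteq> C" using sub[OF S(1)] by (rule bexE)
    show "S \<in> \<C>" using S(2)[OF irr[OF C(1)] C(2)] C(1) by simp
  next
    fix C assume C: "C \<in> \<C>"
    have "T = C" if T: "irreducible_in X T" "C \<subseteq> T" for T
    proof -
      obtain D where "D \<in> \<C>" "T \<subseteq> D" using sub[OF T(1)] by blast
      then show ?thesis using anti[OF C, of D] T(2) by blast
    qed
    then show "C \<in> irreducible_components X"
      using irr[OF C] by (simp add: irreducible_components_def)
  qed
qed


section \<open>Cellule closures cover the picture space\<close>

lemma same_block_quotient:
  assumes "equiv V r" "v \<in> V"
  shows "same_block (V // r) v w \<longleftrightarrow> (v, w) \<in> r"
proof
  assume "same_block (V // r) v w"
  then obtain B where "B \<in> V // r" "{v, w} \<subseteq> B" by blast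
  then show "(v, w) \<in> r" by (rule in_quotient_imp_in_rel[OF assms(1)])
next
  assume "(v, w) \<in> r"
  moreover have "v \<in> r `` {v}" by (rule equiv_class_self[OF assms])
  ultimately show "same_block (V // r) v w" using quotientI[OF assms(2), of r] by blast
qed

lemma pluecker_commute: "pluecker b a = - pluecker a b"
  by (simp add: pluecker_def vec_eq_iff algebra_simps)

lemma pluecker_add_self: "pluecker a (a + b) = pluecker a b"
  by (simp add: pluecker_def vec_eq_iff algebra_simps)

text \<open>The partition is that of coinciding vertices, with its two-element blocks cut into
  singletons. \<open>P\<close> is the value at \<open>t = 0\<close> of a curve lying in the
  corresponding cellule for all but finitely many \<open>t\<close>.\<close>

lemma picture_in_closure:
  fixes P :: "('a::field, 'd::finite, 'v::linorder) picture"
  assumes inf: "infinite (UNIV :: 'a set)" and V: "finite V"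
    and P: "P \<in> picture_space V (complete_edges V)"
  shows "\<exists>\<sigma>. partition_on V \<sigma> \<and> (\<forall>B\<in>\<sigma>. card B \<noteq> 2) \<and>
    P \<in> picture_topology V (complete_edges V) closure_of cellule V (complete_edges V) \<sigma>"
proof -
  let ?E = "complete_edges V"
  define B where "B v = {w\<in>V. fst P w = fst P v}" for v
  \<comment> \<open>\<open>r0\<close> is coincidence of points in \<open>P\<close>; \<open>r\<close>
    is the same relation with the two-element fibres \<open>B v\<close> dissolved.\<close>
  define r0 where "r0 = {(v, w). v \<in> V \<and> w \<in> V \<and> fst P v = fst P w}"
  define r where "r = {(v, w). v \<in> V \<and> w \<in> V \<and> (v = w \<or> fst P v = fst P w \<and> card (B v) \<noteq> 2)}"
  define \<sigma> where "\<sigma> = V // r"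
  have B_eq: "B v = B w" if "fst P v = fst P w" for v w using that by (simp add: B_def)
  have finB: "finite (B v)" for v using V by (simp add: B_def)
  have "equiv V r0"
    by (rule equivI) (auto simp: r0_def refl_on_def sym_def trans_def)
  then have sb0: "same_block (V // r0) v w \<longleftrightarrow> fst P v = fst P w" if "v \<in> V" "w \<in> V" for v w
    using that by (subst same_block_quotient) (auto simp: r0_def)
  have er: "equiv V r"
    by (rule equivI) (auto simp: r_def refl_on_def sym_def trans_def dest: B_eq)
  then have sb: "same_block \<sigma> v w \<longleftrightarrow> v = w \<or> fst P v = fst P w \<and> card (B v) \<noteq> 2"
    if "v \<in> V" "w \<in> V" for v w
    unfolding \<sigma>_def using that by (subst same_block_quotient) (auto simp: r_def)
  have part: "partition_on V \<sigma>" unfolding \<sigma>_def by (rule partition_on_quotient[OF er])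
  have card2: "card C \<noteq> 2" if C: "C \<in> \<sigma>" for C
  proof -
    obtain v where v: "v \<in> V" "C = r `` {v}" using C unfolding \<sigma>_def quotient_def by blast
    have "r `` {v} = (if card (B v) = 2 then {v} else B v)"
      using v(1) by (auto simp: r_def B_def)
    then show ?thesis using v(2) by simp
  qed
  have "P \<in> cellule V ?E (V // r0)"
    using P sb0 by (simp add: cellule_def)
  then obtain x0 y0 where xy: "cell_frame V (V // r0) x0 y0" "P = pic V x0 y0"
    using cellule_frame by blast
  have x0_same: "x0 v = x0 w" if "v \<in> V" "w \<in> V" "fst P v = fst P w" for v w
    using cell_frameD(2)[OF xy(1) that(1,2)] that sb0 by blast
  have x0_diff: "pluecker (x0 v) (x0 w) \<noteq> 0" if "v \<in> V" "w \<in> V" "fst P v \<noteq> fst P w" for v w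
    using cell_frameD(3)[OF xy(1) that(1,2)] that sb0 by blast
  have y0: "y0 e = x0 (Max e)" if "e \<in> ?E" "fst P (Min e) \<noteq> fst P (Max e)" for e
    using cell_frameD(4)[OF xy(1) that(1)] sb0 complete_edges_cases(1,2)[OF that(1)] that(2) by blast
  have fr: "frame V x0 y0" by (rule cell_frameD(1)[OF xy(1)])
  have ln0: "pluecker (x0 (Min e)) (y0 e) \<noteq> 0" if "e \<in> ?E" for e
    using fr that by (simp add: frame_def)
  \<comment> \<open>In each two-element fibre only the larger vertex moves. The fibre
    \<open>B v\<close> is itself an edge, and \<open>y0 (B v)\<close> gives a direction in the line
    of that edge.\<close>
  define mv where "mv v \<longleftrightarrow> card (B v) = 2 \<and> v = Max (B v)" for v
  define x where "x t v = (if mv v then x0 v + t *s y0 (B v) else x0 v)" for t v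
  \<comment> \<open>Lines joining distinct points of \<open>P\<close> must follow their moving
    endpoints; lines at coinciding endpoints keep their generator.\<close>
  define y where "y t e = (if fst P (Min e) = fst P (Max e) then y0 e else x t (Max e))" for t e
  have B2: "B (Min e) = e" "B (Max e) = e" "mv (Max e)" "\<not> mv (Min e)"
    if e: "e \<in> ?E" "fst P (Min e) = fst P (Max e)" "card (B (Min e)) = 2" for e
  proof -
    note ec = complete_edges_cases[OF e(1)]
    have "{Min e, Max e} \<subseteq> B (Min e)" using ec(1,2) e(2) by (simp add: B_def)
    then have sub: "e \<subseteq> B (Min e)" using ec(4) by metis
    have "card e = 2" using e(1) by (simp add: complete_edges_def)
    then show 1: "B (Min e) = e" using card_subset_eq[OF finB sub] e(3) by simp
    then show 2: "B (Max e) = e" using B_eq[OF e(2)] by simp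
    show "mv (Max e)" "\<not> mv (Min e)" using 1 2 ec(3) \<open>card e = 2\<close> by (auto simp: mv_def)
  qed
  have x_0: "x 0 v = x0 v" for v by (simp add: x_def)
  have y_0: "y 0 e = y0 e" if "e \<in> ?E" for e using y0[OF that] by (simp add: y_def x_0)
  have P0: "P = pic V (x 0) (y 0)"
    unfolding xy(2) pic_def using y_0 x_0 by (auto simp: fun_eq_iff restrict_def)
  have px: "polyfun (\<lambda>t. x t v $ i)" for v i
    by (cases "mv v") (simp_all add: x_def polyfun_add polyfun_mult)
  have py: "polyfun (\<lambda>t. y t e $ i)" for e i
    by (cases "fst P (Min e) = fst P (Max e)") (simp_all add: y_def px)
  have "finite {t. pic V (x t) (y t) \<notin> cellule V ?E \<sigma>}"
  proof (rule curve_generic[OF V px py])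
    show "\<exists>t. x t v \<noteq> 0" if "v \<in> V" for v
      using fr that x_0[of v] unfolding frame_def by metis
    show "\<exists>t. pluecker (x t (Min e)) (y t e) \<noteq> 0" if "e \<in> ?E" for e
      using ln0[OF that] x_0 y_0[OF that] by metis
    show "x t (Max e) \<in> vec.span {x t (Min e), y t e}" if e: "e \<in> ?E" for e t
    proof (cases "fst P (Min e) = fst P (Max e)")
      case True
      note ec = complete_edges_cases[OF e]
      have x0e: "x0 (Max e) = x0 (Min e)" using x0_same[OF ec(1,2) True] by simp
      show ?thesis
      proof (cases "card (B (Min e)) = 2")
        case card: True
        have "x t (Max e) = x0 (Min e) + t *s y0 e" "x t (Min e) = x0 (Min e)" "y t e = y0 e"
          using B2[OF e True card] True x0e by (simp_all add: x_def y_def)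
        then show ?thesis by (simp add: vec.span_add vec.span_scale vec.span_base)
      next
        case False
        then have "\<not> mv (Min e)" "\<not> mv (Max e)" using B_eq[OF True] by (auto simp: mv_def)
        then show ?thesis using x0e by (simp add: x_def vec.span_base)
      qed
    next
      case False
      then show ?thesis by (simp add: y_def vec.span_base)
    qed
    show "x t v = x t w" if vw: "v \<in> V" "w \<in> V" "same_block \<sigma> v w" for v w t
    proof (cases "v = w")
      case False
      then have eq: "fst P v = fst P w" and "card (B v) \<noteq> 2" using sb[OF vw(1,2)] vw(3) by auto
      then have "\<not> mv v" "\<not> mv w" using B_eq[OF eq] by (simp_all add: mv_def)
      then show ?thesis using x0_same[OF vw(1,2) eq] by (simp add: x_def)
    qed simp
    show "\<exists>t. pluecker (x t v) (x t w) \<noteq> 0"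
      if vw: "v \<in> V" "w \<in> V" "\<not> same_block \<sigma> v w" for v w
    proof (cases "fst P v = fst P w")
      case True
      then have ne: "v \<noteq> w" and card: "card (B v) = 2" using sb[OF vw(1,2)] vw(3) by auto
      define e where "e = {v, w}"
      have e: "e \<in> ?E" unfolding e_def by (rule complete_edgesI[OF vw(1,2) ne])
      have mm: "v = Min e \<and> w = Max e \<or> v = Max e \<and> w = Min e"
        using ne by (auto simp: e_def min_def max_def)
      have P_e: "fst P (Min e) = fst P (Max e)" using mm True by auto
      then have "card (B (Min e)) = 2" using mm card B_eq by metis
      note B = B2[OF e P_e this]
      \<comment> \<open>At \<open>t = 1\<close> the two points of the fibre are generated by
        \<open>x0 (Min e)\<close> and \<open>x0 (Min e) + y0 e\<close>, whose minors are those of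
        the frame at \<open>e\<close>.\<close>
      have "x 1 (Min e) = x0 (Min e)" "x 1 (Max e) = x0 (Min e) + y0 e"
        using B x0_same[OF complete_edges_cases(1,2)[OF e] P_e] by (auto simp: x_def)
      then have "pluecker (x 1 (Min e)) (x 1 (Max e)) \<noteq> 0"
        using ln0[OF e] by (simp add: pluecker_add_self)
      then have "pluecker (x 1 v) (x 1 w) \<noteq> 0"
        using mm pluecker_commute[of "x 1 v" "x 1 w"] by auto
      then show ?thesis by blast
    next
      case False
      then show ?thesis using x0_diff[OF vw(1,2)] x_0 by metis
    qed
  qed
  from curve_limit_in_closure[OF inf px py cellule_subset this, of 0]
  have "P \<in> picture_topology V ?E closure_of cellule V ?E \<sigma>" using P P0 by simp
  then show ?thesis using part card2 by blast
qed

section \<open>Cellule closures are not nested\<close>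

text \<open>Disjointness leaves one block through each vertex, so the classes of
  \<open>same_block\<close> recover the blocks. Partitions with the same relation are therefore
  equal.\<close>

lemma partition_blocks:
  assumes "partition_on V \<sigma>"
  shows "\<sigma> = (\<lambda>v. {w\<in>V. same_block \<sigma> v w}) ` V"
proof -
  have V: "V = \<Union>\<sigma>" and dis: "disjoint \<sigma>" and ne: "{} \<notin> \<sigma>"
    using assms by (auto simp: partition_on_def)
  have *: "{w\<in>V. same_block \<sigma> v w} = B" if "B \<in> \<sigma>" "v \<in> B" for B v
    using that V disjointD[OF dis] by blast
  show ?thesis
  proof (intro equalityI subsetI)
    fix B assume B: "B \<in> \<sigma>"
    then obtain v where "v \<in> B" using ne by (metis ex_in_conv)
    then show "B \<in> (\<lambda>v. {w\<in>V. same_block \<sigma> v w}) ` V" using *[OF B] B V by blast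
  next
    fix B assume "B \<in> (\<lambda>v. {w\<in>V. same_block \<sigma> v w}) ` V"
    then obtain v where v: "v \<in> V" "B = {w\<in>V. same_block \<sigma> v w}" by blast
    then obtain C where C: "C \<in> \<sigma>" "v \<in> C" using V by blast
    then show "B \<in> \<sigma>" using *[OF C] v(2) by simp
  qed
qed

text \<open>The blocks become distinct points on the line through two coordinate points. An edge
  inside a block only has to pass through the common point of its endpoints, so its direction can be
  prescribed by \<open>k\<close>.\<close>

lemma cellule_witness:
  fixes k :: "'v::linorder set \<Rightarrow> 'd::finite"
  assumes inf: "infinite (UNIV :: 'a::field set)" and V: "finite V" and \<sigma>: "partition_on V \<sigma>"
    and i: "i0 \<noteq> i1" and k: "\<And>e. k e \<noteq> i0" and B0: "u0 \<in> V"
  shows "\<exists>x y. pic V x y \<in> (cellule V (complete_edges V) \<sigma> :: ('a, 'd, 'v) picture set) \<and>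
    (\<forall>v\<in>V. same_block \<sigma> u0 v \<longrightarrow> x v = axis i0 1) \<and>
    (\<forall>e\<in>complete_edges V. same_block \<sigma> (Min e) (Max e) \<longrightarrow> y e = axis (k e) 1)"
proof -
  define blk where "blk v = {w\<in>V. same_block \<sigma> v w}" for v
  have blk: "blk v = blk w \<longleftrightarrow> same_block \<sigma> v w" if "v \<in> V" "w \<in> V" for v w
  proof -
    have V: "V = \<Union>\<sigma>" and dis: "disjoint \<sigma>" using \<sigma> by (auto simp: partition_on_def)
    have *: "blk v = B" if "B \<in> \<sigma>" "v \<in> B" for B v
      unfolding blk_def using that V disjointD[OF dis] by blast
    show ?thesis
    proof
      assume "blk v = blk w"
      then show "same_block \<sigma> v w" using that V * by (metis UnionE)
    qed (use * in blast)
  qed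
  have fin: "finite (blk ` V)" using V by simp
  \<comment> \<open>The infinite field supplies one scalar for each block.\<close>
  obtain T :: "'a set" where T: "finite T" "card T = card (blk ` V)"
    using infinite_arbitrarily_large[OF inf] by blast
  obtain s where s: "bij_betw s (blk ` V) T"
    using finite_same_card_bij[OF fin T(1)] T(2) by auto
  \<comment> \<open>The shift by \<open>s (blk u0)\<close> gives the block of \<open>u0\<close> the
    parameter zero, which puts it at \<open>axis i0 1\<close>.\<close>
  define c where "c v = s (blk v) - s (blk u0)" for v
  have c: "c v = c w \<longleftrightarrow> same_block \<sigma> v w" if "v \<in> V" "w \<in> V" for v w
    using s blk[OF that] that by (auto simp: c_def bij_betw_def inj_on_def)
  define x :: "'v \<Rightarrow> 'a ^ 'd" where "x v = axis i0 1 + c v *s axis i1 1" for v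
  define y where "y e = (if same_block \<sigma> (Min e) (Max e) then axis (k e) 1 else x (Max e))" for e
  have same: "x v = x w" if "v \<in> V" "w \<in> V" "same_block \<sigma> v w" for v w
    using c[OF that(1,2)] that(3) by (simp add: x_def)
  have diff: "pluecker (x v) (x w) \<noteq> 0" if "v \<in> V" "w \<in> V" "\<not> same_block \<sigma> v w" for v w
  proof -
    have "pluecker (x v) (x w) $ i0 $ i1 = c w - c v"
      using i by (simp add: pluecker_def x_def axis_def)
    also have "\<dots> \<noteq> 0" using c[OF that(2,1)] that(3) by auto
    finally show ?thesis by (metis zero_index)
  qed
  have "frame V x y"
    unfolding frame_def
  proof (intro conjI ballI)
    show "x v \<noteq> 0" for v
    proof -
      have "x v $ i0 = 1" using i by (simp add: x_def axis_def)
      then show ?thesis by (metis zero_index zero_neq_one)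
    qed
    fix e assume e: "e \<in> complete_edges V"
    note ec = complete_edges_cases[OF e]
    show "pluecker (x (Min e)) (y e) \<noteq> 0"
    proof (cases "same_block \<sigma> (Min e) (Max e)")
      case True
      have "pluecker (x (Min e)) (y e) $ i0 $ k e = 1"
        unfolding y_def if_P[OF True] using i k[of e] by (simp add: pluecker_def x_def axis_def)
      then show ?thesis by (metis zero_index zero_neq_one)
    next
      case False
      then show ?thesis using diff ec unfolding y_def if_not_P[OF False] by blast
    qed
    show "x (Max e) \<in> vec.span {x (Min e), y e}"
    proof (cases "same_block \<sigma> (Min e) (Max e)")
      case True
      then have "x (Max e) = x (Min e)" using same ec(1,2) by metis
      then show ?thesis by (simp add: vec.span_base)
    next
      case False
      show ?thesis unfolding y_def if_not_P[OF False] by (simp add: vec.span_base)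
    qed
  qed
  then have "pic V x y \<in> cellule V (complete_edges V) \<sigma>"
    using same diff by (intro frame_pic_cellule)
  moreover have "x v = axis i0 1" if "v \<in> V" "same_block \<sigma> u0 v" for v
    using c[OF B0 that(1)] that(2) by (simp add: x_def c_def)
  moreover have "y e = axis (k e) 1" if "same_block \<sigma> (Min e) (Max e)" for e
    unfolding y_def using that by simp
  ultimately show ?thesis by (intro exI[of _ x] exI[of _ y]) simp
qed

text \<open>The minors of \<open>x v\<close> and \<open>x w\<close> are multihomogeneous and vanish
  on the cellule of \<open>\<tau>\<close>, hence also at \<open>P\<close>, where they force the two
  points to agree.\<close>

lemma closure_cellule_refines:
  fixes P :: "('a::field, 'd::finite, 'v) picture"
  assumes P: "P \<in> cellule V E \<sigma>" "P \<in> picture_topology V E closure_of cellule V E \<tau>"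
    and vw: "v \<in> V" "w \<in> V" "same_block \<tau> v w"
  shows "same_block \<sigma> v w"
proof -
  have PS: "P \<in> ambient V E" using P(1) by (auto simp: cellule_def picture_space_def)
  then obtain x p where xp: "hom_coords V E P x p" using hom_coords_exist by blast
  have span: "vec.span {x u} = fst P u" if "u \<in> V" for u
    using xp that by (simp add: hom_coords_def)
  have nz: "x u \<noteq> 0" if "u \<in> V" for u
  proof (rule proj_point_generator_nonzero)
    show "vec.span {x u} \<in> proj_points" using PS span[OF that] that by (auto simp: ambient_def)
  qed
  have "pluecker (x v) (x w) $ i $ j = 0" for i j
  proof -
    define f where "f = (\<lambda>(x :: 'v \<Rightarrow> 'a ^ 'd) (p :: 'v set \<Rightarrow> 'a ^ 'd ^ 'd).
      x v $ i * x w $ j - x v $ j * x w $ i)"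
    have f: "multihom V E ({#Inl v#} + {#Inl w#}) f"
      unfolding f_def using vw by (intro multihom_diff multihom.mult multihom.point_coord)
    have "vanishes V E f Q" if Q: "Q \<in> cellule V E \<tau>" for Q
      unfolding vanishes_def
    proof (intro allI impI)
      fix x p assume "hom_coords V E Q x p"
      then have "vec.span {x v} = vec.span {x w}"
        using vw Q by (simp add: hom_coords_def cellule_def)
      then have "x w \<in> vec.span {x v}" using vec.span_base[of "x w" "{x w}"] by simp
      then obtain c where "x w = c *s x v" by (auto simp: vec.span_singleton)
      then show "f x p = 0" by (simp add: f_def)
    qed
    from vanishes_on_closure[OF f cellule_subset this P(2)] have "f x p = 0"
      using xp by (simp add: vanishes_def)
    then show ?thesis by (simp add: f_def pluecker_def)
  qed
  then have "pluecker (x v) (x w) = 0" by (simp add: vec_eq_iff)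
  then have "fst P v = fst P w"
    using span_singleton_eq_iff[OF nz[OF vw(1)] nz[OF vw(2)]] span vw(1,2) by simp
  then show ?thesis using P(1) vw by (simp add: cellule_def)
qed

text \<open>The determinant of the points where the lines at \<open>{u, v}\<close>, \<open>{u, w}\<close>, \<open>{v, w}\<close> meet
  the hyperplane \<open>x $ i0 = 0\<close>. It vanishes if the three lines are coplanar.\<close>

definition coplanarity_det :: "'d \<Rightarrow> 'd \<Rightarrow> 'd \<Rightarrow> 'd \<Rightarrow> 'v \<Rightarrow> 'v \<Rightarrow> 'v
    \<Rightarrow> ('v \<Rightarrow> 'a::field ^ 'd) \<Rightarrow> ('v set \<Rightarrow> 'a ^ 'd ^ 'd) \<Rightarrow> 'a" where
  "coplanarity_det i0 i1 i2 i3 u v w x p =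
     p {u, v} $ i1 $ i0 * (p {u, w} $ i2 $ i0 * p {v, w} $ i3 $ i0 - p {u, w} $ i3 $ i0 * p {v, w} $ i2 $ i0)
   - p {u, v} $ i2 $ i0 * (p {u, w} $ i1 $ i0 * p {v, w} $ i3 $ i0 - p {u, w} $ i3 $ i0 * p {v, w} $ i1 $ i0)
   + p {u, v} $ i3 $ i0 * (p {u, w} $ i1 $ i0 * p {v, w} $ i2 $ i0 - p {u, w} $ i2 $ i0 * p {v, w} $ i1 $ i0)"

lemma multihom_coplanarity_det:
  assumes "{u, v} \<in> E" "{u, w} \<in> E" "{v, w} \<in> E"
  shows "multihom V E ({#Inr {u, v}#} + ({#Inr {u, w}#} + {#Inr {v, w}#}))
    (coplanarity_det i0 i1 i2 i3 u v w)"
  unfolding coplanarity_det_def[abs_def]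
  by (intro multihom.add multihom_diff multihom.mult multihom.line_coord assms)

text \<open>If exactly two of the three points coincide, two of the lines agree and two rows of the
  determinant are proportional. If all are distinct, the lines are the sides of a triangle and the
  rows are linearly dependent.\<close>

lemma coplanarity_det_vanishes:
  fixes Q :: "('a::field, 'd::finite, 'v::linorder) picture"
  assumes Q: "Q \<in> cellule V (complete_edges V) \<tau>"
    and uvw: "u \<in> V" "v \<in> V" "w \<in> V" "u \<noteq> v" "u \<noteq> w" "v \<noteq> w"
    and nsame: "\<not> (fst Q u = fst Q v \<and> fst Q u = fst Q w)"
  shows "vanishes V (complete_edges V) (coplanarity_det i0 i1 i2 i3 u v w) Q"
  unfolding vanishes_def
proof (intro allI impI)
  let ?E = "complete_edges V"
  fix x p assume xp: "hom_coords V ?E Q x p"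
  have PS: "Q \<in> ambient V ?E" "\<And>e v. e \<in> ?E \<Longrightarrow> v \<in> e \<Longrightarrow> fst Q v \<subseteq> snd Q e"
    using Q by (auto simp: cellule_def picture_space_def)
  have E: "{a, b} \<in> ?E" if "a \<in> {u, v, w}" "b \<in> {u, v, w}" "a \<noteq> b" for a b
    using that uvw by (intro complete_edgesI) auto
  \<comment> \<open>Distinct endpoints determine the line, and so its Pluecker vector up to a
    scalar.\<close>
  have line: "\<exists>c. p {a, b} = (\<chi> i j. c * pluecker (x a) (x b) $ i $ j) \<and>
      snd Q {a, b} = vec.span {x a, x b}"
    if ab: "a \<in> {u, v, w}" "b \<in> {u, v, w}" "fst Q a \<noteq> fst Q b" for a b
  proof -
    have V: "a \<in> V" "b \<in> V" "a \<noteq> b" using ab uvw by auto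
    have e: "{a, b} \<in> ?E" using E ab V by blast
    have sp: "vec.span {x a} = fst Q a" "vec.span {x b} = fst Q b"
      using xp V by (auto simp: hom_coords_def)
    have "fst Q a \<in> proj_points" "fst Q b \<in> proj_points" using PS(1) V by (auto simp: ambient_def)
    then have "x a \<noteq> 0" "x b \<noteq> 0" using proj_point_generator_nonzero sp by metis+
    then have "pluecker (x a) (x b) \<noteq> 0" using span_singleton_eq_iff sp ab(3) by metis
    moreover have "x a \<in> snd Q {a, b}" "x b \<in> snd Q {a, b}"
      using sp PS(2)[OF e] vec.span_base[of "x a" "{x a}"] vec.span_base[of "x b" "{x b}"] by auto
    moreover have "snd Q {a, b} \<in> proj_lines" using PS(1) e by (auto simp: ambient_def)
    ultimately have L: "vec.span {x a, x b} = snd Q {a, b}" by (intro span_eq_line)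
    obtain a' b' where "vec.span {a', b'} = snd Q {a, b}" "p {a, b} = pluecker a' b'"
      using xp e by (auto simp: hom_coords_def)
    then show ?thesis using pluecker_scale[of a' b' "x a" "x b"] L by auto
  qed
  have eq: "\<exists>c. p e = (\<chi> i j. c * p e' $ i $ j)" if e: "e \<in> ?E" "e' \<in> ?E" "snd Q e = snd Q e'" for e e'
  proof -
    obtain a b where 1: "vec.span {a, b} = snd Q e" "p e = pluecker a b"
      using xp e(1) unfolding hom_coords_def by blast
    obtain a' b' where 2: "vec.span {a', b'} = snd Q e'" "p e' = pluecker a' b'"
      using xp e(2) unfolding hom_coords_def by blast
    show ?thesis using pluecker_scale[of a b a' b'] 1 2 e(3) by simp
  qed
  have third: "snd Q {a, c} = snd Q {b, c}"
    if abc: "a \<in> {u, v, w}" "b \<in> {u, v, w}" "c \<in> {u, v, w}" "fst Q a = fst Q b" "fst Q a \<noteq> fst Q c" for a b c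
  proof -
    have V: "a \<in> V" "b \<in> V" using abc uvw by auto
    have "vec.span {x a} = vec.span {x b}" using xp V abc(4) by (simp add: hom_coords_def)
    then have "vec.span {x c, x a} = vec.span {x c, x b}"
      by (simp only: vec.span_insert[of "x c"])
    then have "vec.span {x a, x c} = vec.span {x b, x c}" by (simp only: insert_commute)
    then show ?thesis using line[of a c] line[of b c] abc by auto
  qed
  consider (uv) "fst Q u = fst Q v" "fst Q u \<noteq> fst Q w" | (uw) "fst Q u = fst Q w" "fst Q u \<noteq> fst Q v"
    | (vw) "fst Q v = fst Q w" "fst Q v \<noteq> fst Q u"
    | (distinct) "fst Q u \<noteq> fst Q v" "fst Q u \<noteq> fst Q w" "fst Q v \<noteq> fst Q w"
    using nsame by metis
  then show "coplanarity_det i0 i1 i2 i3 u v w x p = 0"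
  proof cases
    case uv
    then have "snd Q {u, w} = snd Q {v, w}" using third by blast
    then obtain c where "p {u, w} = (\<chi> i j. c * p {v, w} $ i $ j)" using eq E uvw by blast
    then show ?thesis by (simp add: coplanarity_det_def algebra_simps)
  next
    case uw
    then have "snd Q {u, v} = snd Q {w, v}" using third by blast
    then have "snd Q {u, v} = snd Q {v, w}" by (simp add: insert_commute)
    then obtain c where "p {u, v} = (\<chi> i j. c * p {v, w} $ i $ j)" using eq E uvw by blast
    then show ?thesis by (simp add: coplanarity_det_def algebra_simps)
  next
    case vw
    then have "snd Q {v, u} = snd Q {w, u}" using third by blast
    then have "snd Q {u, v} = snd Q {u, w}" by (simp add: insert_commute)
    then obtain c where "p {u, v} = (\<chi> i j. c * p {u, w} $ i $ j)" using eq E uvw by blast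
    then show ?thesis by (simp add: coplanarity_det_def algebra_simps)
  next
    case distinct
    obtain c1 where 1: "p {u, v} = (\<chi> i j. c1 * pluecker (x u) (x v) $ i $ j)" using line[of u v] distinct by blast
    obtain c2 where 2: "p {u, w} = (\<chi> i j. c2 * pluecker (x u) (x w) $ i $ j)" using line[of u w] distinct by blast
    obtain c3 where 3: "p {v, w} = (\<chi> i j. c3 * pluecker (x v) (x w) $ i $ j)" using line[of v w] distinct by blast
    \<comment> \<open>Up to the scalars \<open>c1\<close>, \<open>c2\<close>, \<open>c3\<close>, the
      rows satisfy a linear relation with coefficients \<open>x w $ i0\<close>,
      \<open>- x v $ i0\<close>, \<open>x u $ i0\<close>.\<close>
    show ?thesis unfolding coplanarity_det_def 1 2 3 by (simp add: pluecker_def) algebra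
  qed
qed

text \<open>Both partitions are compared through \<open>same_block\<close>. One implication is the
  closedness of coincidence; the other tests \<open>coplanarity_det\<close> on a picture with three
  independent directions at one point, which takes four coordinate indices.\<close>

lemma cellule_subset_closure_eq:
  fixes \<sigma> \<tau> :: "'v::linorder set set"
  assumes inf: "infinite (UNIV :: 'a::field set)" and V: "finite V" and d: "CARD('d::finite) \<ge> 4"
    and \<sigma>: "partition_on V \<sigma>" "\<And>B. B \<in> \<sigma> \<Longrightarrow> card B \<noteq> 2" and \<tau>: "partition_on V \<tau>"
    and sub: "cellule V (complete_edges V) \<sigma> \<subseteq>
      picture_topology V (complete_edges V) closure_of
        (cellule V (complete_edges V) \<tau> :: ('a, 'd, 'v) picture set)"
  shows "\<sigma> = \<tau>"
proof -
  let ?E = "complete_edges V"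
  have "card {..<4::nat} \<le> card (UNIV :: 'd set)" using d by simp
  then obtain h :: "nat \<Rightarrow> 'd" where h: "inj_on h {..<4}"
    using card_le_inj[of "{..<4::nat}" "UNIV :: 'd set"] by auto
  define i0 i1 i2 i3 where "i0 = h 0" and "i1 = h 1" and "i2 = h 2" and "i3 = h 3"
  have i: "i0 \<noteq> i1" "i0 \<noteq> i2" "i0 \<noteq> i3" "i1 \<noteq> i2" "i1 \<noteq> i3" "i2 \<noteq> i3"
    by (simp_all add: i0_def i1_def i2_def i3_def inj_on_eq_iff[OF h])
  have "same_block \<sigma> v w" if vw: "v \<in> V" "w \<in> V" "same_block \<tau> v w" for v w
  proof -
    obtain x y where P: "pic V x y \<in> (cellule V ?E \<sigma> :: ('a, 'd, 'v) picture set)"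
      using cellule_witness[OF inf V \<sigma>(1) i(1) i(1)[symmetric] vw(1)]
      by (elim exE conjE) (rule that)
    show ?thesis by (rule closure_cellule_refines[OF P subsetD[OF sub P] vw])
  qed
  moreover have "same_block \<tau> v w" if vw: "v \<in> V" "w \<in> V" "same_block \<sigma> v w" for v w
  proof (rule ccontr)
    assume nt: "\<not> same_block \<tau> v w"
    obtain B where B: "B \<in> \<sigma>" "v \<in> B" "w \<in> B" using vw(3) by blast
    have BV: "B \<subseteq> V" using \<sigma>(1) B(1) by (auto simp: partition_on_def)
    have "v \<noteq> w" using nt vw \<tau> by (auto simp: partition_on_def)
    then have "B \<noteq> {v, w}" using \<sigma>(2)[OF B(1)] by auto
    \<comment> \<open>The block contains \<open>v\<close> and \<open>w\<close> but does not have
      size two, so a third vertex exists.\<close>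
    then obtain u where u: "u \<in> B" "u \<noteq> v" "u \<noteq> w" using B by blast
    have same: "same_block \<sigma> a b" if "a \<in> {u, v, w}" "b \<in> {u, v, w}" for a b
      using that u B by blast
    let ?f = "coplanarity_det i0 i1 i2 i3 u v w :: ('v \<Rightarrow> 'a ^ 'd) \<Rightarrow> _"
    have E: "{u, v} \<in> ?E" "{u, w} \<in> ?E" "{v, w} \<in> ?E"
      using u B BV \<open>v \<noteq> w\<close> by (auto intro!: complete_edgesI)
    \<comment> \<open>The three lines leave the common point \<open>axis i0 1\<close> along three
      different coordinate axes.\<close>
    define k where "k e = (if e = {u, v} then i1 else if e = {u, w} then i2 else i3)" for e
    have k: "k e \<noteq> i0" for e using i by (auto simp: k_def)
    have uV: "u \<in> V" using u(1) BV by blast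
    obtain x y where xy: "pic V x y \<in> (cellule V ?E \<sigma> :: ('a, 'd, 'v) picture set)"
      "\<forall>v\<in>V. same_block \<sigma> u v \<longrightarrow> x v = axis i0 1"
      "\<forall>e\<in>?E. same_block \<sigma> (Min e) (Max e) \<longrightarrow> y e = axis (k e) 1"
      using cellule_witness[where k = k, OF inf V \<sigma>(1) i(1) k uV] by (elim exE conjE) (rule that)
    have "vanishes V ?E ?f Q" if Q: "Q \<in> cellule V ?E \<tau>" for Q
    proof (rule coplanarity_det_vanishes[OF Q])
      have "fst Q v \<noteq> fst Q w" using Q nt vw by (auto simp: cellule_def)
      then show "\<not> (fst Q u = fst Q v \<and> fst Q u = fst Q w)" by auto
    qed (use u B BV \<open>v \<noteq> w\<close> in auto)
    from vanishes_on_closure[OF multihom_coplanarity_det[OF E] cellule_subset this]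
    have "vanishes V ?E ?f (pic V x y)" using sub xy(1) by blast
    then have 0: "?f x (coords x y) = 0" using vanishes_pic[OF multihom_coplanarity_det[OF E]] by blast
    have c: "coords x y {a, b} = pluecker (axis i0 1) (axis (k {a, b}) 1)"
      if ab: "a \<in> {u, v, w}" "b \<in> {u, v, w}" "{a, b} \<in> ?E" for a b
    proof -
      have m: "Min {a, b} \<in> {u, v, w}" "Max {a, b} \<in> {u, v, w}"
        using ab by (auto simp: min_def max_def)
      have "x (Min {a, b}) = axis i0 1"
        using bspec[OF xy(2) complete_edges_cases(1)[OF ab(3)]] same[OF _ m(1), of u] by simp
      moreover have "y {a, b} = axis (k {a, b}) 1" using bspec[OF xy(3) ab(3)] same[OF m] by simp
      ultimately show ?thesis by (simp add: coords_def)
    qed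
    have "k {u, v} = i1" "k {u, w} = i2" "k {v, w} = i3"
      using u \<open>v \<noteq> w\<close> by (auto simp: k_def doubleton_eq_iff)
    \<comment> \<open>The matrix of the determinant is minus the identity of size three.\<close>
    then have "?f x (coords x y) = - 1"
      using E i c[of u v] c[of u w] c[of v w]
      by (simp add: coplanarity_det_def pluecker_def axis_def)
    then show False using 0 by simp
  qed
  ultimately have "same_block \<sigma> v w \<longleftrightarrow> same_block \<tau> v w" if "v \<in> V" "w \<in> V" for v w
    using that by (intro iffI) simp_all
  then have "(\<lambda>v. {w\<in>V. same_block \<sigma> v w}) ` V = (\<lambda>v. {w\<in>V. same_block \<tau> v w}) ` V"
    by (intro image_cong refl Collect_cong conj_cong)
  then show ?thesis using partition_blocks[OF \<sigma>(1)] partition_blocks[OF \<tau>] by simp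
qed

text \<open>The cellule closures form a finite family to which
  \<open>irreducible_components_eq\<close> applies. An inclusion between two closures puts the first
  cellule into the second closure, which forces equal partitions.\<close>

theorem theorem2p11:
  fixes d n :: nat
    and X :: "('a::alg_closed_field, 'd::finite, nat) picture topology"
  assumes "CARD('d) = d + 1"
    and "d \<ge> 3"
    and "n \<ge> 2"
    and "X = picture_topology {1..n} (complete_edges {1..n})"
  shows "irreducible_components X =
    {X closure_of (cellule {1..n} (complete_edges {1..n}) \<sigma>) | \<sigma>.
       partition_on {1..n} \<sigma> \<and> (\<forall>B\<in>\<sigma>. card B \<noteq> 2)}"
proof -
  let ?V = "{1..n}"
  let ?E = "complete_edges ?V"
  let ?c = "\<lambda>\<sigma>. cellule ?V ?E \<sigma> :: ('a, 'd, nat) picture set"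
  define \<S> where "\<S> = {\<sigma>. partition_on ?V \<sigma> \<and> (\<forall>B\<in>\<sigma>. card B \<noteq> 2)}"
  note inf = infinite_UNIV_alg_closed[where 'a = 'a] and V = finite_atLeastAtMost[of 1 n]
  note X = assms(4)
  have d4: "CARD('d) \<ge> 4" using assms(1,2) by simp
  then obtain i0 i1 :: 'd where i: "i0 \<noteq> i1"
    using card_le_Suc0_iff_eq[of "UNIV :: 'd set"] by auto
  \<comment> \<open>The vertex \<open>1\<close> serves as the base vertex \<open>u0\<close> of the
    witness for nonemptiness.\<close>
  have "1 \<in> ?V" using assms(3) by simp
  have ne: "?c \<sigma> \<noteq> {}" if "\<sigma> \<in> \<S>" for \<sigma>
  proof -
    have \<sigma>: "partition_on ?V \<sigma>" using that by (simp add: \<S>_def)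
    obtain x y where "pic ?V x y \<in> ?c \<sigma>"
      using cellule_witness[OF inf V \<sigma> i i[symmetric] \<open>1 \<in> ?V\<close>] by (elim exE conjE) (rule that)
    then show ?thesis by (metis empty_iff)
  qed
  have sub: "?c \<sigma> \<subseteq> X closure_of ?c \<sigma>" for \<sigma>
    unfolding X by (rule closure_of_subset) (simp add: topspace_picture_topology cellule_subset)
  have "irreducible_components X = (\<lambda>\<sigma>. X closure_of ?c \<sigma>) ` \<S>"
  proof (rule irreducible_components_eq)
    have "\<S> \<subseteq> Pow (Pow ?V)" by (auto simp: \<S>_def partition_on_def)
    then show "finite ((\<lambda>\<sigma>. X closure_of ?c \<sigma>) ` \<S>)"
      by (meson V finite_Pow_iff finite_imageI finite_subset)
    show "topspace X \<subseteq> \<Union>((\<lambda>\<sigma>. X closure_of ?c \<sigma>) ` \<S>)"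
    proof
      fix P assume "P \<in> topspace X"
      then have "P \<in> picture_space ?V ?E" by (simp add: X topspace_picture_topology)
      from picture_in_closure[OF inf V this]
      show "P \<in> \<Union>((\<lambda>\<sigma>. X closure_of ?c \<sigma>) ` \<S>)"
        unfolding X \<S>_def by (elim exE conjE) (rule UN_I, simp_all)
    qed
  next
    fix C assume "C \<in> (\<lambda>\<sigma>. X closure_of ?c \<sigma>) ` \<S>"
    then obtain \<sigma> where \<sigma>: "\<sigma> \<in> \<S>" "C = X closure_of ?c \<sigma>" by (rule imageE)
    show "closedin X C" unfolding \<sigma>(2) by (rule closedin_closure_of)
    show "irreducible_in X C"
      unfolding \<sigma>(2) X
      by (rule irreducible_in_closure_of[OF irreducible_cellule[OF inf V ne[OF \<sigma>(1)]]])
  next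
    fix C D
    assume "C \<in> (\<lambda>\<sigma>. X closure_of ?c \<sigma>) ` \<S>" "D \<in> (\<lambda>\<sigma>. X closure_of ?c \<sigma>) ` \<S>" and CD: "C \<subseteq> D"
    then obtain \<sigma> \<tau> where \<sigma>: "\<sigma> \<in> \<S>" "C = X closure_of ?c \<sigma>" and \<tau>: "\<tau> \<in> \<S>" "D = X closure_of ?c \<tau>"
      by (elim imageE) (rule that)
    have "?c \<sigma> \<subseteq> X closure_of ?c \<tau>" using sub CD unfolding \<sigma>(2) \<tau>(2) by (rule subset_trans)
    then have "\<sigma> = \<tau>"
      unfolding X using \<sigma>(1) \<tau>(1)
      by (intro cellule_subset_closure_eq[OF inf V d4]) (auto simp: \<S>_def)
    then show "C = D" using \<sigma>(2) \<tau>(2) by simp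
  qed
  also have "\<dots> = {X closure_of ?c \<sigma> | \<sigma>. partition_on ?V \<sigma> \<and> (\<forall>B\<in>\<sigma>. card B \<noteq> 2)}"
    unfolding \<S>_def image_def by blast
  finally show ?thesis .
qed

end
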